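(* Let $D$ be a $t$-partite degree matrix and let $\rho_D=\rho(T_D)$. For every $\varepsilon>0$ and every positive integer $\Delta$ there exist an integer $g=g(D,\varepsilon)$ and a constant $c=c(D,\Delta,\varepsilon)>0$ such that every graph $G$ of order $n$, of maximum degree at most $\Delta$, with subdegree matrix $D$, and with odd girth at least $g$, has at least $cn$ eigenvalues that are smaller than $-\rho_D+\varepsilon$.
   Context: A $t$-partite degree matrix ($t\ge1$) is a square matrix $D=[d_{ij}]_{i,j=1}^t$ with non-negative integer entries satisfying: (D1) if $d_{ij}=0$ then $d_{ji}=0$; (D2) for all $i,k$ there are $m_1=i,\dots,m_s=k$ with $d_{m_jm_{j+1}}>0$ for all $j$; (D3) for every sequence of distinct $m_1,\dots,m_s$, $d_{m_1m_2}\cdots d_{m_{s-1}m_s}d_{m_sm_1}=d_{m_1m_s}d_{m_sm_{s-1}}\cdots d_{m_2m_1}$. $D$ is a degree matrix for a graph $H$ if $V(H)$ has a partition $U_1\cup\cdots\cup U_t$ with every vertex in $U_i$ having exactly $d_{ij}$ neighbors in $U_j$. $T_D$ (the universal cover) is the unique up to isomorphism tree with degree matrix $D$. $D$ is a subdegree matrix for $G$ if there is a graph homomorphism $\pi:T_D\to G$ that is locally 1-1 (for each vertex $x$ of $T_D$, the edges at $x$ are mapped injectively to edges at $\pi(x)$). For a graph $H$ and vertex $v$, $H_r(v)$ is the induced subgraph on vertices at distance at most $r$ from $v$. For a finite graph, $\rho$ is its largest adjacency eigenvalue; for a connected infinite locally finite graph $H$, $\rho(H)=\lim_{r\to\infty}\rho(H_r(v))$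 for any vertex $v$. The odd girth of a graph is the length of a shortest odd cycle ($\infty$ if the graph is bipartite). Eigenvalues are those of the adjacency matrix, counted with multiplicity.
   Formalization: "Subdegree matrix" is taken to mean that every vertex of G lies in the image of some locally 1-1 homomorphism from T_D to G; with only one such homomorphism the claim fails (D=[3], K_{3,3} with a long pendant path). *)

theory Defs
  imports
    "HOL-Library.Extended_Nat"
    "HOL-Library.Disjoint_Sets"
    "HOL-Library.Countable"
    "Jordan_Normal_Form.Char_Poly"
begin

section \<open>Simple graphs, finite or infinite\<close>

record 'a sgraph =
  verts :: "'a set"
  edges :: "'a set set"

definition simple_graph :: "'a sgraph \<Rightarrow> bool" where
  "simple_graph G \<longleftrightarrow>
     (\<forall>e\<in>edges G. \<exists>x y. x \<in> verts G \<and> y \<in> verts G \<and> x \<noteq> y \<and> e = {x, y})"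

definition adj :: "'a sgraph \<Rightarrow> 'a \<Rightarrow> 'a \<Rightarrow> bool" where
  "adj G x y \<longleftrightarrow> {x, y} \<in> edges G"

definition nbrs :: "'a sgraph \<Rightarrow> 'a \<Rightarrow> 'a set" where
  "nbrs G x = {y. adj G x y}"

definition induced :: "'a sgraph \<Rightarrow> 'a set \<Rightarrow> 'a sgraph" where
  "induced G S = \<lparr>verts = verts G \<inter> S, edges = {e \<in> edges G. e \<subseteq> S}\<rparr>"

text \<open>Walks are given by their vertex sequence; the length of a walk is its number of edges.\<close>

definition walk :: "'a sgraph \<Rightarrow> 'a \<Rightarrow> 'a list \<Rightarrow> 'a \<Rightarrow> bool" where
  "walk G u xs v \<longleftrightarrow> xs \<noteq> [] \<and> hd xs = u \<and> last xs = v \<and>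
     set xs \<subseteq> verts G \<and> successively (adj G) xs"

definition connected_graph :: "'a sgraph \<Rightarrow> bool" where
  "connected_graph G \<longleftrightarrow>
     verts G \<noteq> {} \<and> (\<forall>u\<in>verts G. \<forall>v\<in>verts G. \<exists>xs. walk G u xs v)"

definition graph_dist :: "'a sgraph \<Rightarrow> 'a \<Rightarrow> 'a \<Rightarrow> enat" where
  "graph_dist G u v = Inf {enat (length xs - 1) | xs. walk G u xs v}"

definition graph_ball :: "'a sgraph \<Rightarrow> nat \<Rightarrow> 'a \<Rightarrow> 'a sgraph" where
  "graph_ball G r v = induced G {u \<in> verts G. graph_dist G v u \<le> enat r}"

text \<open>A cycle is given by its cyclic sequence of distinct vertices, so its length is the
  length of the list.\<close>

definition cycle :: "'a sgraph \<Rightarrow> 'a list \<Rightarrow> bool" where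
  "cycle G c \<longleftrightarrow> 3 \<le> length c \<and> distinct c \<and>
     (\<forall>i<length c. adj G (c ! i) (c ! (Suc i mod length c)))"

definition tree :: "'a sgraph \<Rightarrow> bool" where
  "tree G \<longleftrightarrow> simple_graph G \<and> connected_graph G \<and> (\<nexists>c. cycle G c)"

text \<open>For a bipartite graph this is the infimum of the empty set, which is \<open>\<infinity>\<close>.\<close>

definition odd_girth :: "'a sgraph \<Rightarrow> enat" where
  "odd_girth G = Inf {enat (length c) | c. cycle G c \<and> odd (length c)}"


section \<open>Adjacency eigenvalues\<close>

text \<open>The vertices of a finite graph are listed in increasing order to index its adjacency
  matrix.\<close>

definition adj_matrix :: "'a::linorder sgraph \<Rightarrow> real mat" where
  "adj_matrix G =
     (let vs = sorted_list_of_set (verts G); n = card (verts G)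
      in mat n n (\<lambda>(i, j). if adj G (vs ! i) (vs ! j) then 1 else 0))"

text \<open>The adjacency matrix is real symmetric, so all roots of its characteristic polynomial
  are real and the root multiplicities are the dimensions of the eigenspaces.\<close>

definition eigenvalues :: "'a::linorder sgraph \<Rightarrow> real multiset" where
  "eigenvalues G = proots (char_poly (adj_matrix G))"

definition largest_eigenvalue :: "'a::linorder sgraph \<Rightarrow> real" where
  "largest_eigenvalue G = Max (set_mset (eigenvalues G))"

text \<open>For an infinite graph, \<open>THE\<close> picks the common limit over all base points; it exists when
  the graph is connected and of bounded degree.\<close>

definition graph_rho :: "'a::linorder sgraph \<Rightarrow> real" where
  "graph_rho G =
     (if finite (verts G) then largest_eigenvalue G
      else (THE l. \<forall>v\<in>verts G. (\<lambda>r. largest_eigenvalue (graph_ball G r v)) \<longlonglongrightarrow> l))"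


section \<open>Degree matrices and universal covers\<close>

text \<open>The classes are indexed by \<open>0, \<dots>, t - 1\<close>. The last three conjuncts are (D1), (D2)
  and (D3).\<close>

definition degree_matrix :: "nat \<Rightarrow> nat mat \<Rightarrow> bool" where
  "degree_matrix t D \<longleftrightarrow>
     1 \<le> t \<and> D \<in> carrier_mat t t \<and>
     (\<forall>i<t. \<forall>j<t. D $$ (i, j) = 0 \<longrightarrow> D $$ (j, i) = 0) \<and>
     (\<forall>i<t. \<forall>k<t. \<exists>ms. ms \<noteq> [] \<and> set ms \<subseteq> {..<t} \<and> hd ms = i \<and> last ms = k \<and>
        successively (\<lambda>a b. D $$ (a, b) > 0) ms) \<and>
     (\<forall>ms. ms \<noteq> [] \<and> set ms \<subseteq> {..<t} \<and> distinct ms \<longrightarrow>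
        (\<Prod>k<length ms. D $$ (ms ! k, ms ! (Suc k mod length ms))) =
        (\<Prod>k<length ms. D $$ (ms ! (Suc k mod length ms), ms ! k)))"

text \<open>Finiteness has to be required separately, since an infinite set has \<open>card\<close> zero.\<close>

definition degree_matrix_for :: "nat mat \<Rightarrow> 'a sgraph \<Rightarrow> bool" where
  "degree_matrix_for D H \<longleftrightarrow>
     (let t = dim_row D in
      \<exists>U :: nat \<Rightarrow> 'a set.
        (\<forall>i<t. U i \<noteq> {}) \<and> disjoint_family_on U {..<t} \<and> verts H = (\<Union>i<t. U i) \<and>
        (\<forall>i<t. \<forall>j<t. \<forall>x\<in>U i.
           finite (nbrs H x \<inter> U j) \<and> card (nbrs H x \<inter> U j) = D $$ (i, j)))"

text \<open>A tree with a degree matrix is connected and locally finite, hence countable, so natural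
  numbers suffice as vertices. The choice is over a nonempty isomorphism class: see
  \<open>universal_cover_exists\<close> below for nonemptiness.\<close>

definition universal_cover :: "nat mat \<Rightarrow> nat sgraph" where
  "universal_cover D = (SOME T. tree T \<and> degree_matrix_for D T)"

definition locally_injective_hom :: "'a sgraph \<Rightarrow> 'b sgraph \<Rightarrow> ('a \<Rightarrow> 'b) \<Rightarrow> bool" where
  "locally_injective_hom H G \<pi> \<longleftrightarrow>
     (\<forall>x\<in>verts H. \<pi> x \<in> verts G) \<and>
     (\<forall>x y. adj H x y \<longrightarrow> adj G (\<pi> x) (\<pi> y)) \<and>
     (\<forall>x\<in>verts H. inj_on \<pi> (nbrs H x))"

text \<open>The locally injective maps from the universal cover must reach all of \<open>G\<close>. One map
  anywhere into \<open>G\<close> would leave the rest of \<open>G\<close> unconstrained, and no bound proportional to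
  the order of \<open>G\<close> could follow: \<open>K\<^sub>3\<^sub>,\<^sub>3\<close> with a long pendant path contains an image of the
  3-regular tree, but has at most six eigenvalues below \<open>-2\<close>. For the one-by-one matrix with
  entry \<open>d\<close> and a finite graph, the condition below says that every vertex has degree at
  least \<open>d\<close>.\<close>

definition subdegree_matrix :: "nat mat \<Rightarrow> 'a sgraph \<Rightarrow> bool" where
  "subdegree_matrix D G \<longleftrightarrow>
     (\<forall>v\<in>verts G. \<exists>\<pi>. locally_injective_hom (universal_cover D) G \<pi> \<and>
        v \<in> \<pi> ` verts (universal_cover D))"


section \<open>Existence of the universal cover\<close>

text \<open>A vertex is the list of steps leading to it from the root \<open>[]\<close>, last step first; a step
  \<open>(j, k)\<close> goes to the \<open>k\<close>-th child in class \<open>j\<close>.\<close>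

fun cls :: "(nat \<times> nat) list \<Rightarrow> nat" where
  "cls [] = 0"
| "cls (p # xs) = fst p"

definition nchildren :: "nat mat \<Rightarrow> (nat \<times> nat) list \<Rightarrow> nat \<Rightarrow> nat" where
  "nchildren D xs j =
     D $$ (cls xs, j) - (if xs \<noteq> [] \<and> cls (tl xs) = j then 1 else 0)"

fun cover_vertex :: "nat mat \<Rightarrow> (nat \<times> nat) list \<Rightarrow> bool" where
  "cover_vertex D [] = True"
| "cover_vertex D (p # xs) \<longleftrightarrow>
     cover_vertex D xs \<and> fst p < dim_row D \<and> snd p < nchildren D xs (fst p)"

definition cover_tree :: "nat mat \<Rightarrow> nat sgraph" where
  "cover_tree D = \<lparr>verts = to_nat ` {xs. cover_vertex D xs},
     edges = {{to_nat xs, to_nat (p # xs)} | p xs. cover_vertex D (p # xs)}\<rparr>"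

lemma adj_cover_tree:
  "adj (cover_tree D) a b \<longleftrightarrow>
    (\<exists>p xs. cover_vertex D (p # xs) \<and>
       (a = to_nat xs \<and> b = to_nat (p # xs) \<or> b = to_nat xs \<and> a = to_nat (p # xs)))"
  unfolding adj_def cover_tree_def by (auto simp: doubleton_eq_iff)

lemma adj_cover_tree':
  "adj (cover_tree D) (to_nat xs) (to_nat ys) \<longleftrightarrow>
     cover_vertex D xs \<and> cover_vertex D ys \<and> (\<exists>p. xs = p # ys \<or> ys = p # xs)"
proof -
  have "cover_vertex D (p # zs) \<Longrightarrow> cover_vertex D zs" for p zs by simp
  then show ?thesis
    unfolding adj_cover_tree by (auto simp del: cover_vertex.simps)
qed

lemma adj_cover_treeE:
  assumes "adj (cover_tree D) a b"
  obtains xs ys where "a = to_nat xs" "b = to_nat ys" "cover_vertex D xs" "cover_vertex D ys"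
    "\<exists>p. xs = p # ys \<or> ys = p # xs"
  using assms unfolding adj_cover_tree by (elim exE conjE disjE) (auto intro: that)

lemma adj_sym: "adj G x y \<Longrightarrow> adj G y x"
  by (simp add: adj_def insert_commute)

lemma walk_rev:
  assumes "walk G u xs v" shows "walk G v (rev xs) u"
proof -
  have "successively (\<lambda>x y. adj G y x) xs"
    using assms unfolding walk_def by (metis adj_sym successively_mono)
  then show ?thesis
    using assms by (simp add: walk_def hd_rev last_rev successively_rev)
qed

lemma walk_append:
  assumes "walk G u xs v" "walk G v ys w" shows "\<exists>zs. walk G u zs w"
proof (cases "tl ys = []")
  case True
  with assms have "v = w" by (cases ys) (auto simp: walk_def)
  with assms show ?thesis by blast
next
  case False
  obtain zs where ys: "ys = v # zs" "zs \<noteq> []"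
    using assms(2) False by (cases ys) (auto simp: walk_def)
  have "walk G u (xs @ zs) w"
    using assms ys by (auto simp: walk_def successively_append_iff successively_Cons)
  then show ?thesis by blast
qed

lemma cover_tree_root_walk:
  assumes "cover_vertex D xs"
  shows "\<exists>w. walk (cover_tree D) (to_nat xs) w (to_nat ([] :: (nat \<times> nat) list))"
  using assms
proof (induction xs)
  case Nil
  then show ?case
    by (intro exI[of _ "[to_nat ([] :: (nat \<times> nat) list)]"])
       (auto simp: walk_def cover_tree_def)
next
  case (Cons p xs)
  then obtain w where
    w: "walk (cover_tree D) (to_nat xs) w (to_nat ([] :: (nat \<times> nat) list))" by auto
  have "adj (cover_tree D) (to_nat (p # xs)) (to_nat xs)"
    using Cons.prems by (auto simp: adj_cover_tree')
  then have "walk (cover_tree D) (to_nat (p # xs)) [to_nat (p # xs), to_nat xs] (to_nat xs)"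
    using Cons.prems by (auto simp: walk_def cover_tree_def)
  with w show ?case by (blast intro: walk_append)
qed

lemma tree_cover_tree: "tree (cover_tree D)"
  unfolding tree_def
proof (intro conjI notI)
  show "simple_graph (cover_tree D)"
    unfolding simple_graph_def
  proof
    fix e assume "e \<in> edges (cover_tree D)"
    then obtain p xs where e: "e = {to_nat xs, to_nat (p # xs)}" "cover_vertex D (p # xs)"
      by (auto simp: cover_tree_def)
    then show "\<exists>x y. x \<in> verts (cover_tree D) \<and> y \<in> verts (cover_tree D) \<and> x \<noteq> y \<and> e = {x, y}"
      by (intro exI[of _ "to_nat xs"] exI[of _ "to_nat (p # xs)"]) (auto simp: cover_tree_def)
  qed
next
  show "connected_graph (cover_tree D)"
    unfolding connected_graph_def
  proof (intro conjI ballI)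
    have "to_nat ([] :: (nat \<times> nat) list) \<in> verts (cover_tree D)"
      by (auto simp: cover_tree_def)
    then show "verts (cover_tree D) \<noteq> {}" by blast
  next
    fix u v assume "u \<in> verts (cover_tree D)" "v \<in> verts (cover_tree D)"
    then obtain xs ys where "u = to_nat xs" "v = to_nat ys" "cover_vertex D xs" "cover_vertex D ys"
      by (auto simp: cover_tree_def)
    then show "\<exists>w. walk (cover_tree D) u w v"
      by (metis cover_tree_root_walk walk_rev walk_append)
  qed
next
  assume "\<exists>c. cycle (cover_tree D) c"
  then obtain c where c: "cycle (cover_tree D) c" by blast
  define n where "n = length c"
  have n: "3 \<le> n" "distinct c" using c by (auto simp: cycle_def n_def)
  have adj: "adj (cover_tree D) (c ! i) (c ! (Suc i mod n))" if "i < n" for i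
    using c that by (auto simp: cycle_def n_def)
  define lst where "lst i = (from_nat (c ! i) :: (nat \<times> nat) list)" for i
  have cl: "c ! i = to_nat (lst i)" if "i < n" for i
    using adj[OF that] by (elim adj_cover_treeE) (auto simp: lst_def)
  have step: "\<exists>p. lst i = p # lst (Suc i mod n) \<or> lst (Suc i mod n) = p # lst i" if "i < n" for i
    using adj[OF that] cl[OF that] cl[of "Suc i mod n"] that by (auto simp: adj_cover_tree')
  obtain m where m: "m < n" "\<And>i. i < n \<Longrightarrow> length (lst i) \<le> length (lst m)"
  proof -
    have "finite ((\<lambda>i. length (lst i)) ` {..<n})" "(\<lambda>i. length (lst i)) ` {..<n} \<noteq> {}"
      using n by (auto simp: lessThan_empty_iff)
    then have "Max ((\<lambda>i. length (lst i)) ` {..<n}) \<in> (\<lambda>i. length (lst i)) ` {..<n}"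
      by (rule Max_in)
    then obtain m where "m < n" "length (lst m) = Max ((\<lambda>i. length (lst i)) ` {..<n})"
      by auto
    then show ?thesis by (intro that[of m]) auto
  qed
  define a where "a = (if m = 0 then n - 1 else m - 1)"
  define b where "b = Suc m mod n"
  have ab: "a < n" "b < n" "Suc a mod n = m" "a \<noteq> b"
    using n m by (auto simp: a_def b_def mod_Suc)
  have "tl (lst m) = lst b"
    using step[OF m(1)] m(2)[OF ab(2)] by (auto simp: b_def)
  moreover have "tl (lst m) = lst a"
    using step[OF ab(1)] m(2)[OF ab(1)] ab(3) by auto
  ultimately have "c ! a = c ! b" using cl ab by simp
  with ab n show False by (simp add: nth_eq_iff_index_eq n_def)
qed

lemma cls_less: "degree_matrix t D \<Longrightarrow> cover_vertex D xs \<Longrightarrow> cls xs < t"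
  by (cases xs) (auto simp: degree_matrix_def)

lemma nbrs_cover_tree:
  assumes "cover_vertex D xs"
  shows "nbrs (cover_tree D) (to_nat xs) \<inter> {to_nat ys | ys. cover_vertex D ys \<and> cls ys = j} =
    to_nat ` ((if j < dim_row D then (\<lambda>k. (j, k) # xs) ` {..<nchildren D xs j} else {}) \<union>
              (if xs \<noteq> [] \<and> cls (tl xs) = j then {tl xs} else {}))"
    (is "?L = to_nat ` ?R")
proof -
  have "to_nat ys \<in> ?L \<longleftrightarrow> ys \<in> ?R" for ys
    using assms by (cases xs) (auto simp: nbrs_def adj_cover_tree')
  moreover have "?L \<subseteq> range (to_nat :: (nat \<times> nat) list \<Rightarrow> nat)" by auto
  ultimately show ?thesis by blast
qed

lemma degree_matrix_for_cover_tree: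
  assumes D: "degree_matrix t D"
  shows "degree_matrix_for D (cover_tree D)"
proof -
  define U where "U i = {to_nat ys | ys. cover_vertex D ys \<and> cls ys = i}" for i
  have t: "dim_row D = t" "0 < t" using D by (auto simp: degree_matrix_def)
  have reach: "\<exists>xs. cover_vertex D xs \<and> cls xs = last ms"
    if "ms \<noteq> []" "hd ms = 0" "set ms \<subseteq> {..<t}" "successively (\<lambda>a b. D $$ (a, b) > 0) ms" for ms
    using that
  proof (induction ms rule: rev_induct)
    case (snoc j ms)
    show ?case
    proof (cases "ms = []")
      case True
      then show ?thesis using snoc.prems by (intro exI[of _ "[]"]) auto
    next
      case False
      then obtain xs where xs: "cover_vertex D xs" "cls xs = last ms"
        using snoc by (auto simp: successively_append_iff)
      have pos: "D $$ (cls xs, j) > 0"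
        using snoc.prems False xs by (auto simp: successively_append_iff)
      show ?thesis
      proof (cases "xs \<noteq> [] \<and> cls (tl xs) = j")
        case True
        then show ?thesis using xs by (intro exI[of _ "tl xs"]) (cases xs; auto)
      next
        case False
        then have "cover_vertex D ((j, 0) # xs)"
          using xs pos snoc.prems t by (auto simp: nchildren_def)
        then show ?thesis by (intro exI[of _ "(j, 0) # xs"]) auto
      qed
    qed
  qed auto
  have "U i \<noteq> {}" if i: "i < t" for i
  proof -
    have "\<exists>ms. ms \<noteq> [] \<and> set ms \<subseteq> {..<t} \<and> hd ms = 0 \<and> last ms = i \<and>
        successively (\<lambda>a b. D $$ (a, b) > 0) ms"
      using D t i by (simp add: degree_matrix_def)
    then show ?thesis using reach unfolding U_def by blast
  qed
  moreover have "disjoint_family_on U {..<t}"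
    by (auto simp: disjoint_family_on_def U_def)
  moreover have "verts (cover_tree D) = (\<Union>i<t. U i)"
    using cls_less[OF D] by (auto simp: cover_tree_def U_def)
  moreover have "finite (nbrs (cover_tree D) x \<inter> U j) \<and>
      card (nbrs (cover_tree D) x \<inter> U j) = D $$ (i, j)"
    if i: "i < t" and j: "j < t" and x: "x \<in> U i" for i j x
  proof -
    obtain xs where xs: "x = to_nat xs" "cover_vertex D xs" "cls xs = i"
      using x by (auto simp: U_def)
    define C where "C = (\<lambda>k. (j, k) # xs) ` {..<nchildren D xs j}"
    define P where "P = (if xs \<noteq> [] \<and> cls (tl xs) = j then {tl xs} else {})"
    have eq: "nbrs (cover_tree D) x \<inter> U j = to_nat ` (C \<union> P)"
      using nbrs_cover_tree[OF xs(2), of j] j t xs(1) by (simp add: U_def C_def P_def)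
    have fin: "finite C" "finite P" by (auto simp: C_def P_def)
    have disj: "C \<inter> P = {}" by (auto simp: C_def P_def dest: arg_cong[of _ _ length])
    have cC: "card C = nchildren D xs j" by (simp add: C_def card_image inj_on_def)
    have "card (C \<union> P) = D $$ (i, j)"
    proof (cases "xs \<noteq> [] \<and> cls (tl xs) = j")
      case True
      then obtain p ys where ys: "xs = p # ys" "cls ys = j" by (cases xs) auto
      have "D $$ (j, i) > 0" using xs ys by (auto simp: nchildren_def)
      then have "D $$ (i, j) > 0" using D i j unfolding degree_matrix_def by (metis gr0I less_numeral_extra(3))
      then show ?thesis
        using True fin disj xs by (simp add: card_Un_disjoint cC P_def nchildren_def)
    next
      case False
      then show ?thesis using xs by (auto simp: cC P_def nchildren_def)
    qed
    then show ?thesis using eq fin by (simp add: card_image)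
  qed
  ultimately show ?thesis unfolding degree_matrix_for_def Let_def t by blast
qed

lemma universal_cover_exists:
  assumes "degree_matrix t D"
  shows "tree (universal_cover D)" "degree_matrix_for D (universal_cover D)"
proof -
  have "tree (universal_cover D) \<and> degree_matrix_for D (universal_cover D)"
    unfolding universal_cover_def
    by (rule someI[of _ "cover_tree D"])
       (simp add: tree_cover_tree degree_matrix_for_cover_tree[OF assms])
  then show "tree (universal_cover D)" "degree_matrix_for D (universal_cover D)" by auto
qed

end

theory Submission
  imports Defs "Jordan_Normal_Form.Spectral_Radius" "HOL-Analysis.L2_Norm"
begin

text \<open>Write \<open>T\<close> for the universal cover. Some finitely supported \<open>f \<ge> 0\<close> on \<open>T\<close> has Rayleigh quotient
  above \<open>\<rho>\<^sub>D - \<epsilon>\<close>. Any two vertices of \<open>T\<close> in the same class are related by a locally injective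
  self-map of \<open>T\<close>, and every vertex is within bounded distance of every class, so around each
  vertex \<open>v\<close> of \<open>G\<close> there is a locally injective \<open>\<pi> : T \<rightarrow> G\<close> that carries the support of \<open>f\<close> into
  a ball of fixed radius \<open>R\<close> about \<open>v\<close>. The function \<open>h \<ge> 0\<close> on \<open>G\<close> for which \<open>h(u)\<^sup>2\<close> is the sum of
  \<open>f(x)\<^sup>2\<close> over the fibre \<open>\<pi>(x) = u\<close> has the norm of \<open>f\<close> and, by Cauchy-Schwarz, at least its quadratic
  form. If the odd girth exceeds \<open>2R + 1\<close> the ball is bipartite, and flipping the signs of \<open>h\<close> on one side gives a vector of
  Rayleigh quotient below \<open>-\<rho>\<^sub>D + \<epsilon>\<close>. Linearly many such balls are pairwise disjoint and
  non-adjacent, so their vectors span a space on which the quadratic form lies below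
  \<open>-\<rho>\<^sub>D + \<epsilon>\<close>, whose dimension bounds the number of small eigenvalues from below.\<close>

section \<open>Real symmetric matrices\<close>

text \<open>The spectrum over the complex numbers is nonempty. Moving the symmetric matrix across
  the Hermitian product \<open>z \<bullet>c z\<close> shows that an eigenvalue equals its own
  conjugate. It is thus a real root of the real characteristic polynomial and has a real
  eigenvector, which is then normalised.\<close>

lemma real_symmetric_eigenvector:
  fixes A :: "real mat"
  assumes A: "A \<in> carrier_mat n n" and sym: "transpose_mat A = A" and n: "n > 0"
  obtains e v where "v \<in> carrier_vec n" "v \<bullet> v = 1" "A *\<^sub>v v = e \<cdot>\<^sub>v v"
proof -
  define C where "C = map_mat complex_of_real A"
  have C: "C \<in> carrier_mat n n" using A by (simp add: C_def)
  from spectrum_non_empty[OF C] n obtain k where "eigenvalue C k"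
    by (auto simp: spectrum_def)
  then obtain z where z: "z \<in> carrier_vec n" "z \<noteq> 0\<^sub>v n" "C *\<^sub>v z = k \<cdot>\<^sub>v z"
    using C by (auto simp: eigenvalue_def eigenvector_def)
  have symC: "transpose_mat C = C"
    using sym by (metis C_def map_mat_transpose)
  have conjC: "conjugate (C *\<^sub>v z) = C *\<^sub>v conjugate z"
    using C z(1) A by (intro eq_vecI) (auto simp: C_def scalar_prod_def)
  have "k * (z \<bullet>c z) = (C *\<^sub>v z) \<bullet>c z"
    using z by simp
  also have "\<dots> = z \<bullet> (C *\<^sub>v conjugate z)"
    using transpose_vec_mult_scalar[of C n n "conjugate z" z] C z(1) symC by simp
  also have "\<dots> = z \<bullet>c (k \<cdot>\<^sub>v z)"
    using conjC z(3) by simp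
  also have "\<dots> = cnj k * (z \<bullet>c z)"
    using z(1) by (simp add: conjugate_smult_vec)
  finally have "k = cnj k" using z by simp
  then obtain e where e: "k = complex_of_real e"
    by (metis complex_cnj_cancel_iff Reals_cases Reals_cnj_iff)
  have "poly (char_poly C) k = 0"
    using \<open>eigenvalue C k\<close> eigenvalue_root_char_poly[OF C] by simp
  then have "poly (char_poly A) e = 0"
    by (simp add: C_def e of_real_hom.char_poly_hom[OF A])
  then have "eigenvalue A e" using eigenvalue_root_char_poly[OF A] by simp
  then obtain w where w: "w \<in> carrier_vec n" "w \<noteq> 0\<^sub>v n" "A *\<^sub>v w = e \<cdot>\<^sub>v w"
    using A by (auto simp: eigenvalue_def eigenvector_def)
  have "w \<bullet>c w > 0" using w by (metis conjugate_square_greater_0_vec)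
  then have pos: "w \<bullet> w > 0" by simp
  define v where "v = (1 / sqrt (w \<bullet> w)) \<cdot>\<^sub>v w"
  have "v \<bullet> v = 1" using w pos by (simp add: v_def)
  moreover have "A *\<^sub>v v = e \<cdot>\<^sub>v v" 
    using w A by (simp add: v_def mult_mat_vec smult_smult_assoc mult.commute)
  ultimately show ?thesis using w that[of v e] by (simp add: v_def)
qed

text \<open>For \<open>v\<close> other than the first unit vector, \<open>W\<close> reflects in the
  hyperplane orthogonal to \<open>u\<close>, the difference of \<open>v\<close> and that unit
  vector. As \<open>v\<close> has norm 1, the squared norm of \<open>u\<close> is
  \<open>2 * (1 - v $ 0)\<close>, so the usual factor 2 over this squared norm is
  \<open>c\<close>.\<close>

lemma householder_reflection:
  fixes v :: "real vec"
  assumes v: "v \<in> carrier_vec n" "v \<bullet> v = 1" and n: "n > 0"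
  obtains W where "W \<in> carrier_mat n n" "transpose_mat W = W" "W * W = 1\<^sub>m n"
    "W *\<^sub>v unit_vec n 0 = v"
proof -
  define u where "u i = v $ i - (if i = 0 then 1 else 0)" for i
  \<comment> \<open>For \<open>v = e\<^sub>0\<close> the junk value \<open>c = 0\<close> gives \<open>W = 1\<close>, which is what is wanted.\<close>
  define c where "c = 1 / (1 - v $ 0)"
  define W where "W = mat n n (\<lambda>(i, j). (if i = j then 1 else 0) - c * u i * u j)"
  have vv: "(\<Sum>i<n. v $ i * v $ i) = 1"
    using v by (simp add: scalar_prod_def atLeast0LessThan)
  have uu: "(\<Sum>i<n. u i * u i) = 2 * (1 - v $ 0)"
  proof -
    have "(\<Sum>i<n. u i * u i) = (\<Sum>i<n. v $ i * v $ i + (if i = 0 then 1 - 2 * v $ 0 else 0))"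
      by (intro sum.cong) (auto simp: u_def algebra_simps)
    then show ?thesis using vv n by (simp add: sum.distrib)
  qed
  have W: "W \<in> carrier_mat n n" by (simp add: W_def)
  have cuu: "c * c * (\<Sum>i<n. u i * u i) = 2 * c"
    unfolding uu c_def by (auto simp: divide_simps)
  have "W * W = 1\<^sub>m n"
  proof (rule eq_matI)
    fix i j assume "i < dim_row (1\<^sub>m n)" "j < dim_col (1\<^sub>m n)"
    then have ij: "i < n" "j < n" by auto
    have "(W * W) $$ (i, j) = (\<Sum>k<n. W $$ (i, k) * W $$ (k, j))"
      using ij W by (simp add: scalar_prod_def atLeast0LessThan)
    also have "\<dots> = (\<Sum>k<n. (if k = i then (if i = j then 1 else 0) - c * u i * u j else 0)
        - (if k = j then c * u i * u j else 0) + u i * u j * (c * c * (u k * u k)))"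
      using ij by (intro sum.cong) (auto simp: W_def algebra_simps)
    also have "\<dots> = (if i = j then 1 else 0) - 2 * c * u i * u j 
        + u i * u j * (c * c * (\<Sum>k<n. u k * u k))"
      using ij by (simp add: sum.distrib sum_subtractf sum_distrib_left)
    also have "\<dots> = (if i = j then 1 else 0)" unfolding cuu by simp
    finally show "(W * W) $$ (i, j) = 1\<^sub>m n $$ (i, j)" using ij by simp
  qed (use W in auto)
  moreover have "transpose_mat W = W"
    by (rule eq_matI) (auto simp: W_def)
  moreover have "W *\<^sub>v unit_vec n 0 = v"
  proof (rule eq_vecI)
    fix i assume "i < dim_vec v"
    then have i: "i < n" using v by simp
    have eq: "(W *\<^sub>v unit_vec n 0) $ i = (if i = 0 then 1 else 0) - c * u i * u 0"
      using i n W by (simp add: W_def)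
    show "(W *\<^sub>v unit_vec n 0) $ i = v $ i"
    proof (cases "v $ 0 = 1")
      \<comment> \<open>A unit vector with first entry 1 is the first unit vector, so
        \<open>u\<close> vanishes.\<close>
      case True
      then have "(\<Sum>i<n. u i * u i) = 0" using uu by simp
      then have "u i = 0" using i by (simp add: sum_nonneg_eq_0_iff)
      then show ?thesis unfolding eq by (simp add: u_def split: if_splits)
    next
      case False
      then have "c * u 0 = -1" by (simp add: c_def u_def field_simps)
      then have "c * u i * u 0 = - u i" by (metis mult.commute mult.left_commute mult_minus1)
      then show ?thesis unfolding eq by (simp add: u_def)
    qed
  qed (use v W in auto)
  ultimately show ?thesis using that W by blast
qed

text \<open>Deflation: conjugating by a reflection that carries the first unit vector to a unit
  eigenvector clears the first column off the diagonal. Symmetry clears the first row too, and the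
  induction hypothesis treats the remaining block. The rows of \<open>Q\<close> are orthonormal
  eigenvectors.\<close>

lemma real_symmetric_diagonalization:
  fixes A :: "real mat"
  assumes "A \<in> carrier_mat n n" "transpose_mat A = A"
  shows "\<exists>Q D. Q \<in> carrier_mat n n \<and> D \<in> carrier_mat n n \<and> diagonal_mat D \<and>
    transpose_mat Q * Q = 1\<^sub>m n \<and> A = transpose_mat Q * D * Q"
  using assms
proof (induction n arbitrary: A)
  case 0
  then show ?case
    by (intro exI[of _ "1\<^sub>m 0"]) (auto simp: diagonal_mat_def intro!: eq_matI)
next
  case (Suc n)
  note A = Suc.prems(1)
  obtain e v where v: "v \<in> carrier_vec (Suc n)" "v \<bullet> v = 1" "A *\<^sub>v v = e \<cdot>\<^sub>v v"
    using real_symmetric_eigenvector[OF Suc.prems zero_less_Suc] by blast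
  obtain W where W: "W \<in> carrier_mat (Suc n) (Suc n)" "transpose_mat W = W"
    "W * W = 1\<^sub>m (Suc n)" "W *\<^sub>v unit_vec (Suc n) 0 = v"
    using householder_reflection[OF v(1,2) zero_less_Suc] by blast
  define A' where "A' = W * A * W"
  have A': "A' \<in> carrier_mat (Suc n) (Suc n)" using W A by (simp add: A'_def)
  have symA': "transpose_mat A' = A'"
    using W A Suc.prems(2)
    by (simp add: A'_def transpose_mult[of _ "Suc n" "Suc n" _ "Suc n"] assoc_mult_mat[of _ "Suc n" "Suc n" _ "Suc n" _ "Suc n"])
  have WA: "A = W * A' * W"
  proof -
    have "W * A' * W = (W * W) * A * (W * W)"
      using W(1) A unfolding A'_def
      by (simp add: assoc_mult_mat[of _ "Suc n" "Suc n" _ "Suc n" _ "Suc n"])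
    then show ?thesis using W A by simp
  qed
  have Wv: "W *\<^sub>v v = unit_vec (Suc n) 0"
    using W by (metis assoc_mult_mat_vec one_mult_mat_vec unit_vec_carrier)
  have A'0: "A' *\<^sub>v unit_vec (Suc n) 0 = e \<cdot>\<^sub>v unit_vec (Suc n) 0"
  proof -
    have "A' *\<^sub>v unit_vec (Suc n) 0 = W *\<^sub>v (A *\<^sub>v (W *\<^sub>v unit_vec (Suc n) 0))"
      using W(1) A by (simp add: A'_def assoc_mult_mat_vec[of _ "Suc n" "Suc n" _ "Suc n"])
    then show ?thesis using W v Wv by (simp add: mult_mat_vec)
  qed
  have col0: "A' $$ (i, 0) = (if i = 0 then e else 0)" if "i < Suc n" for i
  proof -
    have "A' $$ (i, 0) = (A' *\<^sub>v unit_vec (Suc n) 0) $ i"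
      using that A' by simp
    then show ?thesis using that unfolding A'0 by simp
  qed
  have row0: "A' $$ (0, i) = (if i = 0 then e else 0)" if "i < Suc n" for i
    using col0[OF that] symA' A' that by (metis carrier_matD index_transpose_mat(1) zero_less_Suc)
  define B where "B = mat n n (\<lambda>(i, j). A' $$ (Suc i, Suc j))"
  have B: "B \<in> carrier_mat n n" by (simp add: B_def)
  have symB: "transpose_mat B = B"
    using symA' A' unfolding B_def
    by (intro eq_matI) (auto, metis Suc_less_eq carrier_matD index_transpose_mat(1))
  from Suc.IH[OF B symB] obtain Q D where QD: "Q \<in> carrier_mat n n" "D \<in> carrier_mat n n"
    "diagonal_mat D" "transpose_mat Q * Q = 1\<^sub>m n" "B = transpose_mat Q * D * Q"
    by blast
  define Q1 where "Q1 = four_block_mat (1\<^sub>m 1) (0\<^sub>m 1 n) (0\<^sub>m n 1) Q"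
  define E where "E = mat 1 1 (\<lambda>_. e)"
  define D1 where "D1 = four_block_mat E (0\<^sub>m 1 n) (0\<^sub>m n 1) D"
  have E: "E \<in> carrier_mat 1 1" by (simp add: E_def)
  have A'_block: "A' = four_block_mat E (0\<^sub>m 1 n) (0\<^sub>m n 1) B"
    using A' by (intro eq_matI) (auto simp: E_def B_def col0 row0)
  have Q1T: "transpose_mat Q1 = four_block_mat (1\<^sub>m 1) (0\<^sub>m 1 n) (0\<^sub>m n 1) (transpose_mat Q)"
    unfolding Q1_def using QD(1) by (subst transpose_four_block_mat[of _ 1 1 _ n _ n]) auto
  have Q1: "Q1 \<in> carrier_mat (Suc n) (Suc n)" using four_block_carrier_mat[OF one_carrier_mat QD(1), of 1] by (simp add: Q1_def)
  have D1: "D1 \<in> carrier_mat (Suc n) (Suc n)" using four_block_carrier_mat[OF E QD(2)] by (simp add: D1_def)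
  have Q1Q1: "transpose_mat Q1 * Q1 = 1\<^sub>m (Suc n)"
    unfolding Q1T unfolding Q1_def using QD
    by (subst mult_four_block_mat[of _ 1 1 _ n _ n _ _ 1 _ n]) (auto intro!: eq_matI)
  have Q1D1: "transpose_mat Q1 * D1 * Q1 = A'"
    unfolding Q1T A'_block unfolding Q1_def D1_def QD(5) using QD E
    by (subst mult_four_block_mat[of _ 1 1 _ n _ n _ _ 1 _ n];
        (subst mult_four_block_mat[of _ 1 1 _ n _ n _ _ 1 _ n])?) (auto)
  have "diagonal_mat D1"
    using QD(2,3) E unfolding diagonal_mat_def D1_def by (auto simp: less_Suc_eq_0_disj) blast
  moreover have "transpose_mat (Q1 * W) * (Q1 * W) = 1\<^sub>m (Suc n)"
  proof -
    have "transpose_mat (Q1 * W) * (Q1 * W) = W * (transpose_mat Q1 * Q1) * W"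
      using W(1,2) Q1
      by (simp add: transpose_mult[of _ "Suc n" "Suc n" _ "Suc n"] assoc_mult_mat[of _ "Suc n" "Suc n" _ "Suc n" _ "Suc n"])
    then show ?thesis using Q1Q1 W by simp
  qed
  moreover have "A = transpose_mat (Q1 * W) * D1 * (Q1 * W)"
  proof -
    have "transpose_mat (Q1 * W) * D1 * (Q1 * W) = W * (transpose_mat Q1 * D1 * Q1) * W"
      using W(1,2) Q1 D1
      by (simp add: transpose_mult[of _ "Suc n" "Suc n" _ "Suc n"] assoc_mult_mat[of _ "Suc n" "Suc n" _ "Suc n" _ "Suc n"])
    then show ?thesis using Q1D1 WA by simp
  qed
  ultimately show ?case
    using Q1 D1 W(1) by (intro exI[of _ "Q1 * W"] exI[of _ D1]) auto
qed

text \<open>Padding the \<open>N\<close> equations with zero rows gives a singular square matrix; a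
  nonzero kernel vector is the solution.\<close>

lemma homogeneous_system:
  fixes a :: "nat \<Rightarrow> nat \<Rightarrow> real"
  assumes "N < k"
  shows "\<exists>c. (\<exists>i<k. c i \<noteq> 0) \<and> (\<forall>j<N. (\<Sum>i<k. a j i * c i) = 0)"
proof -
  define M where "M = mat k k (\<lambda>(j, i). if j < N then a j i else 0)"
  have M: "M \<in> carrier_mat k k" by (simp add: M_def)
  \<comment> \<open>Since \<open>N < k\<close>, row \<open>N\<close> of \<open>M\<close> is one of
    the zero rows, so the transpose kills the unit vector with index \<open>N\<close>.\<close>
  have "transpose_mat M *\<^sub>v unit_vec k N = 0\<^sub>v k"
    using assms by (intro eq_vecI) (auto simp: M_def)
  moreover have "unit_vec k N \<noteq> (0\<^sub>v k :: real vec)"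
    using assms by simp
  ultimately have "det (transpose_mat M) = 0"
    using M by (subst det_0_iff_vec_prod_zero_field[of _ k]) (auto intro!: exI[of _ "unit_vec k N"])
  then have "det M = 0" using det_transpose[OF M] by simp
  then obtain v where v: "v \<in> carrier_vec k" "v \<noteq> 0\<^sub>v k" "M *\<^sub>v v = 0\<^sub>v k"
    using det_0_iff_vec_prod_zero_field[OF M] by blast
  have "\<exists>i<k. v $ i \<noteq> 0" using v(1,2) by (metis carrier_vecD eq_vecI index_zero_vec)
  moreover have "(\<Sum>i<k. a j i * v $ i) = 0" if "j < N" for j
  proof -
    have "(M *\<^sub>v v) $ j = (\<Sum>i<k. a j i * v $ i)"
      using that assms v(1) by (simp add: M_def scalar_prod_def atLeast0LessThan)
    then show ?thesis using v(3) that assms by simp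
  qed
  ultimately show ?thesis by blast
qed

text \<open>\<open>L\<close> is the orthogonal matrix of the diagonalization with its products
  written out as sums. Norm and quadratic form become diagonal in the same coordinates, with weights
  1 and \<open>es ! i\<close>.\<close>

lemma real_symmetric_sum_of_squares:
  fixes A :: "real mat"
  assumes A: "A \<in> carrier_mat n n" and sym: "transpose_mat A = A"
  shows "\<exists>es L. length es = n \<and> char_poly A = (\<Prod>e\<leftarrow>es. [:- e, 1:]) \<and>
    (\<forall>f. (\<Sum>i<n. (f i)\<^sup>2) = (\<Sum>i<n. (\<Sum>j<n. L i j * f j)\<^sup>2) \<and>
      (\<Sum>i<n. \<Sum>j<n. A $$ (i, j) * f i * f j) = (\<Sum>i<n. es ! i * (\<Sum>j<n. L i j * f j)\<^sup>2))"
proof -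
  obtain Q D where QD: "Q \<in> carrier_mat n n" "D \<in> carrier_mat n n" "diagonal_mat D"
    "transpose_mat Q * Q = 1\<^sub>m n" "A = transpose_mat Q * D * Q"
    using real_symmetric_diagonalization[OF assms] by blast
  define es where "es = diag_mat D"
  have "Q * transpose_mat Q = 1\<^sub>m n"
    using mat_mult_left_right_inverse[of "transpose_mat Q" n Q] QD by simp
  then have "similar_mat A D"
    using QD A by (intro similar_matI[of _ _ "transpose_mat Q" Q n]) auto
  moreover have "upper_triangular D" using QD(2,3) by (auto simp: diagonal_mat_def)
  ultimately have cp: "char_poly A = (\<Prod>e\<leftarrow>es. [:- e, 1:])"
    using char_poly_upper_triangular[OF QD(2)] by (simp add: es_def char_poly_similar)
  have len: "length es = n" using QD(2) by (simp add: es_def diag_mat_def)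
  show ?thesis
  proof (intro exI[of _ es] exI[of _ "\<lambda>i j. Q $$ (i, j)"] conjI allI len cp)
    fix f :: "nat \<Rightarrow> real"
    define x where "x = vec n f"
    define y where "y = Q *\<^sub>v x"
    have x: "x \<in> carrier_vec n" and y: "y \<in> carrier_vec n" using QD by (auto simp: x_def y_def)
    have yi: "y $ i = (\<Sum>j<n. Q $$ (i, j) * f j)" if "i < n" for i
      using that QD(1) by (simp add: y_def x_def scalar_prod_def atLeast0LessThan)
    have "(\<Sum>i<n. (f i)\<^sup>2) = x \<bullet> x"
      by (simp add: x_def scalar_prod_def atLeast0LessThan power2_eq_square)
    also have "\<dots> = x \<bullet> ((transpose_mat Q * Q) *\<^sub>v x)" using QD(4) x by simp
    also have "\<dots> = x \<bullet> (transpose_mat Q *\<^sub>v y)"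
      using QD(1) x by (simp add: y_def assoc_mult_mat_vec[of _ n n _ n])
    also have "\<dots> = y \<bullet> y"
      using transpose_vec_mult_scalar[of "transpose_mat Q" n n y x] QD(1) x y by (simp add: y_def)
    also have "\<dots> = (\<Sum>i<n. (\<Sum>j<n. Q $$ (i, j) * f j)\<^sup>2)"
      using y by (simp add: scalar_prod_def atLeast0LessThan power2_eq_square yi)
    finally show "(\<Sum>i<n. (f i)\<^sup>2) = (\<Sum>i<n. (\<Sum>j<n. Q $$ (i, j) * f j)\<^sup>2)" .
    have "(\<Sum>i<n. \<Sum>j<n. A $$ (i, j) * f i * f j) = x \<bullet> (A *\<^sub>v x)"
      using A by (simp add: x_def scalar_prod_def atLeast0LessThan sum_distrib_left mult_ac)
    also have "\<dots> = x \<bullet> (transpose_mat Q *\<^sub>v (D *\<^sub>v y))"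
      using QD(1,2) x unfolding QD(5) by (simp add: y_def assoc_mult_mat_vec[of _ n n _ n])
    also have "\<dots> = y \<bullet> (D *\<^sub>v y)"
      using transpose_vec_mult_scalar[of "transpose_mat Q" n n "D *\<^sub>v y" x] QD(1,2) x y by (simp add: y_def)
    also have "\<dots> = (\<Sum>i<n. es ! i * (y $ i)\<^sup>2)"
    proof -
      have "(D *\<^sub>v y) $ i = es ! i * y $ i" if "i < n" for i
      proof -
        have "(D *\<^sub>v y) $ i = (\<Sum>j<n. D $$ (i, j) * y $ j)"
          using that QD(2) y by (simp add: scalar_prod_def atLeast0LessThan)
        also have "\<dots> = (\<Sum>j<n. if j = i then D $$ (i, i) * y $ i else 0)"
          using that QD(2,3) by (intro sum.cong) (auto simp: diagonal_mat_def)
        also have "\<dots> = es ! i * y $ i" using that QD(2) by (simp add: es_def diag_mat_def)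
        finally show ?thesis .
      qed
      then show ?thesis using y QD(2)
        by (simp add: scalar_prod_def atLeast0LessThan power2_eq_square mult_ac)
    qed
    finally show "(\<Sum>i<n. \<Sum>j<n. A $$ (i, j) * f i * f j) =
        (\<Sum>i<n. es ! i * (\<Sum>j<n. Q $$ (i, j) * f j)\<^sup>2)" by (simp add: yi)
  qed
qed

section \<open>The quadratic form of a graph\<close>

text \<open>The sum runs over ordered pairs, so in a simple graph each edge inside \<open>S\<close>
  counts twice, as it does in the quadratic form of the adjacency matrix.\<close>

definition qform :: "'a sgraph \<Rightarrow> 'a set \<Rightarrow> ('a \<Rightarrow> real) \<Rightarrow> real" where
  "qform G S f = (\<Sum>x\<in>S. \<Sum>y\<in>S. if adj G x y then f x * f y else 0)"

lemma qform_extend: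
  assumes S: "S \<subseteq> S'" and fin: "finite S'"
  shows "qform G S' (\<lambda>x. if x \<in> S then f x else 0) = qform G S f"
proof -
  have "(\<Sum>y\<in>S'. if adj G x y then (if x \<in> S then f x else 0) * (if y \<in> S then f y else 0) else 0) =
      (\<Sum>y\<in>S. if adj G x y then (if x \<in> S then f x else 0) * f y else 0)" for x
    using S fin by (intro sum.mono_neutral_cong_right) auto
  then show ?thesis
    unfolding qform_def using S fin finite_subset[OF S fin]
    by (simp only:) (intro sum.mono_neutral_cong_right; auto intro!: sum.neutral cong: if_cong)
qed

lemma proots_prod_list_linear:
  "proots (\<Prod>e\<leftarrow>es. [:- e, 1:]) = mset (es :: 'a :: idom list)"
proof (induction es)
  case (Cons e es)
  have "(\<Prod>e\<leftarrow>es. [:- e, 1:]) \<noteq> 0" by (auto simp: prod_list_zero_iff)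
  then show ?case using Cons by (simp add: proots_mult del: mult_pCons_left)
qed simp

text \<open>Indexing by positions in the list \<open>es\<close>, not by eigenvalues, keeps
  multiplicities: counting small eigenvalues becomes counting positions.\<close>

lemma adjacency_sum_of_squares:
  fixes G :: "'a::linorder sgraph"
  assumes fin: "finite (verts G)"
  shows "\<exists>es L. length es = card (verts G) \<and> eigenvalues G = mset es \<and>
    (\<forall>f. (\<Sum>x\<in>verts G. (f x)\<^sup>2) = (\<Sum>i<length es. (\<Sum>x\<in>verts G. L i x * f x)\<^sup>2) \<and>
      qform G (verts G) f = (\<Sum>i<length es. es ! i * (\<Sum>x\<in>verts G. L i x * f x)\<^sup>2))"
proof -
  define vs where "vs = sorted_list_of_set (verts G)"
  define n where "n = card (verts G)"
  define A where "A = adj_matrix G"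
  have A: "A = mat n n (\<lambda>(i, j). if adj G (vs ! i) (vs ! j) then 1 else 0)"
    by (simp add: A_def adj_matrix_def Let_def vs_def n_def)
  have "transpose_mat A = A"
    unfolding A by (rule eq_matI) (auto dest: adj_sym)
  then obtain es L where es: "length es = n" "char_poly A = (\<Prod>e\<leftarrow>es. [:- e, 1:])"
    and L: "\<And>f. (\<Sum>i<n. (f i)\<^sup>2) = (\<Sum>i<n. (\<Sum>j<n. L i j * f j)\<^sup>2)"
      "\<And>f. (\<Sum>i<n. \<Sum>j<n. A $$ (i, j) * f i * f j) = (\<Sum>i<n. es ! i * (\<Sum>j<n. L i j * f j)\<^sup>2)"
    using real_symmetric_sum_of_squares[of A n] unfolding A by auto
  have bij: "bij_betw ((!) vs) {..<n} (verts G)"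
    using fin by (intro bij_betw_nth) (auto simp: vs_def n_def)
  note reindex = sum.reindex_bij_betw[OF bij]
  define M where "M i x = L i (inv_into {..<n} ((!) vs) x)" for i x
  have M: "M i (vs ! j) = L i j" if "j < n" for i j
    using that bij_betw_imp_inj_on[OF bij] by (simp add: M_def)
  have LM: "(\<Sum>j<n. L i j * f (vs ! j)) = (\<Sum>x\<in>verts G. M i x * f x)" for i f
    unfolding reindex[symmetric] by (intro sum.cong) (auto simp: M)
  show ?thesis
  proof (intro exI[of _ es] exI[of _ M] conjI allI)
    show "length es = card (verts G)" using es by (simp add: n_def)
    show "eigenvalues G = mset es"
      using es(2) by (simp add: eigenvalues_def A_def proots_prod_list_linear)
    fix f :: "'a \<Rightarrow> real"
    show "(\<Sum>x\<in>verts G. (f x)\<^sup>2) = (\<Sum>i<length es. (\<Sum>x\<in>verts G. M i x * f x)\<^sup>2)"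
      using L(1)[of "\<lambda>i. f (vs ! i)"] es(1) by (simp add: LM reindex[of "\<lambda>x. (f x)\<^sup>2"])
    have "qform G (verts G) f = (\<Sum>i<n. \<Sum>j<n. A $$ (i, j) * f (vs ! i) * f (vs ! j))"
      unfolding qform_def reindex[symmetric] by (intro sum.cong) (auto simp: A)
    then show "qform G (verts G) f = (\<Sum>i<length es. es ! i * (\<Sum>x\<in>verts G. M i x * f x)\<^sup>2)"
      using L(2)[of "\<lambda>i. f (vs ! i)"] es(1) by (simp add: LM)
  qed
qed

section \<open>Counting and bounding eigenvalues by test functions\<close>

lemma homogeneous_system_finite:
  fixes a :: "'j \<Rightarrow> 'i \<Rightarrow> real"
  assumes "finite I" "finite J" "card J < card I"
  shows "\<exists>c. (\<exists>i\<in>I. c i \<noteq> 0) \<and> (\<forall>j\<in>J. (\<Sum>i\<in>I. a j i * c i) = 0)"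
proof -
  obtain p q where p: "bij_betw p {..<card I} I" and q: "bij_betw q {..<card J} J"
    using assms ex_bij_betw_nat_finite unfolding atLeast0LessThan by meson
  obtain c where c: "\<exists>i<card I. c i \<noteq> 0"
    "\<And>j. j < card J \<Longrightarrow> (\<Sum>i<card I. a (q j) (p i) * c i) = 0"
    using homogeneous_system[OF assms(3), of "\<lambda>j i. a (q j) (p i)"] by blast
  define d where "d i = c (inv_into {..<card I} p i)" for i
  have d: "d (p i) = c i" if "i < card I" for i
    using that bij_betw_imp_inj_on[OF p] by (simp add: d_def)
  have "(\<Sum>i\<in>I. a j i * d i) = 0" if "j \<in> J" for j
  proof -
    have "j \<in> q ` {..<card J}" using that bij_betw_imp_surj_on[OF q] by simp
    then obtain m where "m < card J" "j = q m" by auto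
    have "(\<Sum>i\<in>I. a j i * d i) = (\<Sum>i<card I. a j (p i) * d (p i))"
      by (rule sum.reindex_bij_betw[OF p, symmetric])
    also have "\<dots> = (\<Sum>i<card I. a (q m) (p i) * c i)"
      using \<open>j = q m\<close> by (intro sum.cong) (auto simp: d)
    finally show ?thesis using c(2)[OF \<open>m < card J\<close>] by simp
  qed
  moreover obtain m where "m < card I" "c m \<noteq> 0" using c(1) by blast
  then have "\<exists>i\<in>I. d i \<noteq> 0"
    using d[of m] bij_betw_apply[OF p, of m] by force
  ultimately show ?thesis by blast
qed

text \<open>A Courant-Fischer argument. With fewer eigenvalues below \<open>\<mu>\<close> than test
  functions, a nontrivial combination \<open>h\<close> of the test functions is orthogonal to the
  eigenvectors of all those eigenvalues, so its form is at least \<open>\<mu>\<close> times its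
  squared norm. Because the supports are separated, \<open>h\<close> inherits the opposite strict
  inequality from the \<open>f i\<close>.\<close>

lemma card_le_eigenvalues_below:
  fixes G :: "'a::linorder sgraph" and f :: "'i \<Rightarrow> 'a \<Rightarrow> real"
  assumes fin: "finite (verts G)" "finite I"
    and S: "\<And>i. i \<in> I \<Longrightarrow> S i \<subseteq> verts G"
    and sep: "\<And>i j x y. i \<in> I \<Longrightarrow> j \<in> I \<Longrightarrow> i \<noteq> j \<Longrightarrow> x \<in> S i \<Longrightarrow> y \<in> S j \<Longrightarrow> x \<noteq> y \<and> \<not> adj G x y"
    and neg: "\<And>i. i \<in> I \<Longrightarrow> qform G (S i) (f i) < \<mu> * (\<Sum>x\<in>S i. (f i x)\<^sup>2)"
  shows "card I \<le> size {#x \<in># eigenvalues G. x < \<mu>#}"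
proof (rule ccontr)
  assume less: "\<not> card I \<le> size {#x \<in># eigenvalues G. x < \<mu>#}"
  let ?V = "verts G"
  obtain es L where es: "eigenvalues G = mset es"
    and L: "\<And>f. (\<Sum>x\<in>?V. (f x)\<^sup>2) = (\<Sum>p<length es. (\<Sum>x\<in>?V. L p x * f x)\<^sup>2)"
      "\<And>f. qform G ?V f = (\<Sum>p<length es. es ! p * (\<Sum>x\<in>?V. L p x * f x)\<^sup>2)"
    using adjacency_sum_of_squares[OF fin(1)] by blast
  define P where "P = {p. p < length es \<and> es ! p < \<mu>}"
  have "size {#x \<in># eigenvalues G. x < \<mu>#} = card P"
    by (simp add: es P_def length_filter_conv_card flip: mset_filter)
  with less have "card P < card I" by simp
  define F where "F i x = (if x \<in> S i then f i x else 0)" for i x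
  \<comment> \<open>Cross terms vanish in the norm, where \<open>x = y\<close>, and in the form,
    where \<open>x\<close> and \<open>y\<close> are adjacent; one fact covers both.\<close>
  have FF: "F i x * F j y = 0" if "i \<in> I" "j \<in> I" "i \<noteq> j" "x = y \<or> adj G x y" for i j x y
    using that sep[of i j x y] by (auto simp: F_def)
  obtain c where c: "\<exists>i\<in>I. c i \<noteq> 0"
    "\<And>p. p \<in> P \<Longrightarrow> (\<Sum>i\<in>I. (\<Sum>x\<in>?V. L p x * F i x) * c i) = 0"
    using homogeneous_system_finite[OF fin(2) _ \<open>card P < card I\<close>,
        of "\<lambda>p i. \<Sum>x\<in>?V. L p x * F i x"] by (auto simp: P_def)
  define h where "h x = (\<Sum>i\<in>I. c i * F i x)" for x
  have Lh: "(\<Sum>x\<in>?V. L p x * h x) = 0" if "p \<in> P" for p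
  proof -
    have "(\<Sum>x\<in>?V. L p x * h x) = (\<Sum>i\<in>I. (\<Sum>x\<in>?V. L p x * F i x) * c i)"
      unfolding h_def sum_distrib_left sum_distrib_right
      by (subst sum.swap) (simp add: mult_ac)
    then show ?thesis using c(2)[OF that] by simp
  qed
  \<comment> \<open>In eigenvector coordinates the terms with \<open>p\<close> in \<open>P\<close>
    are zero, and outside \<open>P\<close> the weight \<open>es ! p\<close> is at least
    \<open>\<mu>\<close>.\<close>
  have "\<mu> * (\<Sum>x\<in>?V. (h x)\<^sup>2) \<le> qform G ?V h"
    unfolding L sum_distrib_left
  proof (intro sum_mono)
    fix p assume "p \<in> {..<length es}"
    then show "\<mu> * (\<Sum>x\<in>?V. L p x * h x)\<^sup>2 \<le> es ! p * (\<Sum>x\<in>?V. L p x * h x)\<^sup>2"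
      by (cases "p \<in> P") (auto simp: Lh P_def intro!: mult_right_mono)
  qed
  have hh: "h x * h y = (\<Sum>i\<in>I. (c i)\<^sup>2 * (F i x * F i y))" if "x = y \<or> adj G x y" for x y
  proof -
    have "h x * h y = (\<Sum>i\<in>I. \<Sum>j\<in>I. c i * F i x * (c j * F j y))"
      by (simp add: h_def sum_product)
    also have "\<dots> = (\<Sum>i\<in>I. \<Sum>j\<in>I. if j = i then (c i)\<^sup>2 * (F i x * F i y) else 0)"
      using FF that by (intro sum.cong) (auto simp: power2_eq_square)
    finally show ?thesis using fin(2) by simp
  qed
  have norm: "(\<Sum>x\<in>?V. (h x)\<^sup>2) = (\<Sum>i\<in>I. (c i)\<^sup>2 * (\<Sum>x\<in>S i. (f i x)\<^sup>2))"
  proof -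
    have "(\<Sum>x\<in>?V. (h x)\<^sup>2) = (\<Sum>i\<in>I. (c i)\<^sup>2 * (\<Sum>x\<in>?V. F i x * F i x))"
      by (simp add: power2_eq_square[of "h _"] hh sum_distrib_left) (rule sum.swap)
    also have "\<dots> = (\<Sum>i\<in>I. (c i)\<^sup>2 * (\<Sum>x\<in>S i. (f i x)\<^sup>2))"
      using S fin(1) by (intro sum.cong refl arg_cong[of _ _ "(*) _"] sum.mono_neutral_cong_right)
        (auto simp: F_def power2_eq_square)
    finally show ?thesis .
  qed
  have qF: "qform G ?V (F i) = qform G (S i) (f i)" if "i \<in> I" for i
    unfolding F_def using qform_extend[OF S[OF that] fin(1)] .
  have qf: "qform G ?V h = (\<Sum>i\<in>I. (c i)\<^sup>2 * qform G (S i) (f i))"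
  proof -
    have "qform G ?V h = (\<Sum>x\<in>?V. \<Sum>y\<in>?V. \<Sum>i\<in>I. (c i)\<^sup>2 * (if adj G x y then F i x * F i y else 0))"
      unfolding qform_def by (intro sum.cong refl) (auto simp: hh)
    also have "\<dots> = (\<Sum>i\<in>I. (c i)\<^sup>2 * qform G ?V (F i))"
      unfolding qform_def sum_distrib_left
      by (rule trans[OF _ sum.swap], rule sum.cong[OF refl], rule sum.swap)
    finally show ?thesis using qF by simp
  qed
  have "qform G ?V h < \<mu> * (\<Sum>x\<in>?V. (h x)\<^sup>2)"
    unfolding qf norm sum_distrib_left[of \<mu> _ I]
  \<comment> \<open>Terms with \<open>c i = 0\<close> give only equality; strictness comes from one
    nonzero coefficient.\<close>
  proof (rule sum_strict_mono_ex1[OF fin(2)])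
    show "\<forall>i\<in>I. (c i)\<^sup>2 * qform G (S i) (f i) \<le> \<mu> * ((c i)\<^sup>2 * (\<Sum>x\<in>S i. (f i x)\<^sup>2))"
    proof
      fix i assume "i \<in> I"
      then have "(c i)\<^sup>2 * qform G (S i) (f i) \<le> (c i)\<^sup>2 * (\<mu> * (\<Sum>x\<in>S i. (f i x)\<^sup>2))"
        by (intro mult_left_mono less_imp_le[OF neg]) auto
      then show "(c i)\<^sup>2 * qform G (S i) (f i) \<le> \<mu> * ((c i)\<^sup>2 * (\<Sum>x\<in>S i. (f i x)\<^sup>2))"
        by (simp add: mult.left_commute)
    qed
    show "\<exists>i\<in>I. (c i)\<^sup>2 * qform G (S i) (f i) < \<mu> * ((c i)\<^sup>2 * (\<Sum>x\<in>S i. (f i x)\<^sup>2))"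
    proof -
      obtain i where i: "i \<in> I" "c i \<noteq> 0" using c(1) by blast
      have "(c i)\<^sup>2 * qform G (S i) (f i) < (c i)\<^sup>2 * (\<mu> * (\<Sum>x\<in>S i. (f i x)\<^sup>2))"
        using i neg by (intro mult_strict_left_mono) auto
      then show ?thesis using i(1) by (metis mult.left_commute)
    qed
  qed
  with \<open>\<mu> * (\<Sum>x\<in>?V. (h x)\<^sup>2) \<le> qform G ?V h\<close> show False by simp
qed

lemma largest_eigenvalue_rayleigh:
  fixes G :: "'a::linorder sgraph"
  assumes fin: "finite (verts G)" and ne: "verts G \<noteq> {}"
  shows "qform G (verts G) f \<le> largest_eigenvalue G * (\<Sum>x\<in>verts G. (f x)\<^sup>2)"
    and "\<exists>f. (\<Sum>x\<in>verts G. (f x)\<^sup>2) > 0 \<and>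
      qform G (verts G) f = largest_eigenvalue G * (\<Sum>x\<in>verts G. (f x)\<^sup>2)"
proof -
  let ?V = "verts G"
  obtain es L where es: "eigenvalues G = mset es" "length es = card ?V"
    and L: "\<And>f. (\<Sum>x\<in>?V. (f x)\<^sup>2) = (\<Sum>p<length es. (\<Sum>x\<in>?V. L p x * f x)\<^sup>2)"
      "\<And>f. qform G ?V f = (\<Sum>p<length es. es ! p * (\<Sum>x\<in>?V. L p x * f x)\<^sup>2)"
    using adjacency_sum_of_squares[OF fin] by blast
  have "length es > 0" using es(2) fin ne by (simp add: card_gt_0_iff)
  then have lam: "largest_eigenvalue G = Max (set es)" and "set es \<noteq> {}"
    by (auto simp: largest_eigenvalue_def es(1))
  then have "largest_eigenvalue G \<in> set es" by simp
  then obtain q where q: "q < length es" "es ! q = largest_eigenvalue G"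
    by (auto simp: in_set_conv_nth)
  show "qform G ?V f \<le> largest_eigenvalue G * (\<Sum>x\<in>?V. (f x)\<^sup>2)"
    unfolding L sum_distrib_left by (intro sum_mono mult_right_mono) (auto simp: lam)
  \<comment> \<open>There is one condition fewer than there are vertices, so some nonzero
    \<open>f\<close> has all coordinates zero except the one with index \<open>q\<close>. Such an
    \<open>f\<close> attains the bound.\<close>
  have "card ({..<length es} - {q}) < card ?V" using q(1) es(2) by simp
  from homogeneous_system_finite[OF fin _ this, of L] obtain f where
    f: "\<exists>x\<in>?V. f x \<noteq> 0" "\<And>p. p < length es \<Longrightarrow> p \<noteq> q \<Longrightarrow> (\<Sum>x\<in>?V. L p x * f x) = 0"
    by auto
  have "(\<Sum>x\<in>?V. (f x)\<^sup>2) > 0"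
    using f(1) fin by (metis sum_pos2 zero_less_power2 zero_le_power2)
  moreover have "qform G ?V f = largest_eigenvalue G * (\<Sum>x\<in>?V. (f x)\<^sup>2)"
    unfolding L sum_distrib_left q(2)[symmetric]
    using f(2) by (intro sum.cong) (auto simp: mult_eq_0_iff)
  ultimately show "\<exists>f. (\<Sum>x\<in>?V. (f x)\<^sup>2) > 0 \<and>
      qform G ?V f = largest_eigenvalue G * (\<Sum>x\<in>?V. (f x)\<^sup>2)" by blast
qed

section \<open>Homogeneity of the universal cover\<close>

lemma simple_graphD:
  assumes "simple_graph G" "adj G x y"
  shows "x \<in> verts G" "y \<in> verts G" "x \<noteq> y"
  using assms unfolding simple_graph_def adj_def by (fastforce simp: doubleton_eq_iff)+

section \<open>Non-backtracking walks in acyclic graphs\<close>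

definition nonbacktracking :: "'a list \<Rightarrow> bool" where
  "nonbacktracking ws \<longleftrightarrow> (\<forall>k. Suc (Suc k) < length ws \<longrightarrow> ws ! k \<noteq> ws ! Suc (Suc k))"

lemma nonbacktracking_short [simp]: "nonbacktracking [x]" "nonbacktracking [x, y]"
  by (auto simp: nonbacktracking_def)

lemma nonbacktracking_Cons3 [simp]:
  "nonbacktracking (x # y # z # ws) \<longleftrightarrow> x \<noteq> z \<and> nonbacktracking (y # z # ws)"
  unfolding nonbacktracking_def
  by (rule iffI, force, clarify, rename_tac k, case_tac k) auto

lemma nonbacktracking_Cons: "nonbacktracking (x # ws) \<Longrightarrow> nonbacktracking ws"
  unfolding nonbacktracking_def by force

lemma nonbacktracking_rev:
  assumes "nonbacktracking ws" shows "nonbacktracking (rev ws)"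
  unfolding nonbacktracking_def
proof (intro allI impI)
  fix k assume k: "Suc (Suc k) < length (rev ws)"
  define m where "m = length ws - Suc (Suc (Suc k))"
  have "length ws - Suc k = Suc (Suc m)" "length ws - Suc (Suc (Suc k)) = m" "Suc (Suc m) < length ws"
    using k by (auto simp: m_def)
  moreover from this have "ws ! m \<noteq> ws ! Suc (Suc m)"
    using assms by (simp add: nonbacktracking_def)
  ultimately show "rev ws ! k \<noteq> rev ws ! Suc (Suc k)"
    using k by (simp add: rev_nth)
qed

text \<open>Three consecutive vertices of the joined list lie in \<open>xs @ [p]\<close>, are
  centred at \<open>p\<close>, or lie in \<open>p # ys\<close>.\<close>

lemma nonbacktracking_append:
  assumes "nonbacktracking (xs @ [p])" "nonbacktracking (p # ys)" "xs \<noteq> []" "ys \<noteq> []"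
    "last xs \<noteq> hd ys"
  shows "nonbacktracking (xs @ p # ys)"
  unfolding nonbacktracking_def
proof (intro allI impI)
  fix k assume k: "Suc (Suc k) < length (xs @ p # ys)"
  consider "Suc (Suc k) \<le> length xs" | "Suc k = length xs" | "length xs \<le> k" by linarith
  then show "(xs @ p # ys) ! k \<noteq> (xs @ p # ys) ! Suc (Suc k)"
  proof cases
    case 1
    then have "(xs @ [p]) ! k \<noteq> (xs @ [p]) ! Suc (Suc k)"
      using assms(1) by (simp add: nonbacktracking_def)
    with 1 show ?thesis by (auto simp: nth_append nth_Cons')
  next
    case 2
    then have "k = length xs - 1" by simp
    with 2 assms(3-5) show ?thesis by (simp add: nth_append last_conv_nth hd_conv_nth)
  next
    case 3
    then obtain m where m: "k = length xs + m" using le_Suc_ex by blast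
    with k assms(2) show ?thesis by (simp add: nonbacktracking_def nth_append)
  qed
qed

text \<open>Between two equal entries at the least possible distance \<open>d\<close>, the entries
  are distinct and close up to a cycle. Distance 1 would be a loop and distance 2 a backtrack, so
  \<open>d\<close> is at least 3.\<close>

lemma nonbacktracking_distinct:
  assumes G: "simple_graph G" and acyclic: "\<nexists>c. cycle G c"
    and ws: "successively (adj G) ws" "nonbacktracking ws"
  shows "distinct ws"
proof (rule ccontr)
  define R where "R d \<longleftrightarrow> (\<exists>i. 0 < d \<and> i + d < length ws \<and> ws ! i = ws ! (i + d))" for d
  assume "\<not> distinct ws"
  then obtain i j where "i < j" "j < length ws" "ws ! i = ws ! j"
    unfolding distinct_conv_nth by (metis linorder_neqE_nat)
  then have "R (j - i)" unfolding R_def by (intro exI[of _ i]) auto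
  then have R: "R (LEAST d. R d)" by (rule LeastI)
  define d where "d = (LEAST d. R d)"
  from R obtain i where i: "0 < d" "i + d < length ws" "ws ! i = ws ! (i + d)"
    by (auto simp: R_def d_def)
  have least: "d \<le> e" if "R e" for e using that by (simp add: d_def Least_le)
  have adj: "adj G (ws ! k) (ws ! Suc k)" if "Suc k < length ws" for k
    using ws(1) that by (simp add: successively_conv_nth)
  have "\<not> adj G x x" for x using simple_graphD(3)[OF G] by blast
  then have "d \<noteq> 1" using i adj[of i] by auto
  moreover have "d \<noteq> 2" using i ws(2) by (auto simp: nonbacktracking_def numeral_2_eq_2)
  ultimately have "3 \<le> d" using i(1) by linarith
  define c where "c = take d (drop i ws)"
  have c: "length c = d" "\<And>k. k < d \<Longrightarrow> c ! k = ws ! (i + k)" using i by (auto simp: c_def)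
  have "distinct c"
    unfolding distinct_conv_nth
  proof (intro allI impI)
    have *: "c ! k \<noteq> c ! l" if "k < l" "l < d" for k l
    proof
      assume "c ! k = c ! l"
      then have "R (l - k)"
        unfolding R_def using that i by (intro exI[of _ "i + k"]) (simp add: c)
      then show False using least[of "l - k"] that by simp
    qed
    fix k l assume "k < length c" "l < length c" "k \<noteq> l"
    then show "c ! k \<noteq> c ! l" using * by (metis c(1) linorder_neqE_nat)
  qed
  moreover have "adj G (c ! k) (c ! (Suc k mod length c))" if "k < length c" for k
  proof (cases "Suc k = d")
    case True
    then have "adj G (ws ! (i + k)) (ws ! Suc (i + k))" using i by (intro adj) simp
    moreover have "Suc (i + k) = i + d" using True by simp
    ultimately show ?thesis using True i c(2)[of 0] c(2)[of k] c(1) that by simp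
  next
    case False
    then show ?thesis using that i adj[of "i + k"] c by simp
  qed
  ultimately have "cycle G c" using \<open>3 \<le> d\<close> c(1) by (simp add: cycle_def)
  with acyclic show False by blast
qed

text \<open>Paths are stored with the current endpoint first, so that extending a path is a \<open>Cons\<close>.\<close>

definition nbpath :: "'a sgraph \<Rightarrow> 'a \<Rightarrow> 'a list \<Rightarrow> bool" where
  "nbpath G r ws \<longleftrightarrow> ws \<noteq> [] \<and> last ws = r \<and> successively (adj G) ws \<and> nonbacktracking ws"

lemma nbpath_Nil [simp]: "\<not> nbpath G r []"
  and nbpath_single [simp]: "nbpath G r [x] \<longleftrightarrow> x = r"
  and nbpath_pair: "nbpath G r [x, y] \<longleftrightarrow> y = r \<and> adj G x y"
  and nbpath_Cons3: "nbpath G r (x # y # z # ws) \<longleftrightarrow> adj G x y \<and> x \<noteq> z \<and> nbpath G r (y # z # ws)"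
  by (auto simp: nbpath_def)

lemma nbpath_tl: "nbpath G r (x # y # ws) \<Longrightarrow> adj G x y \<and> nbpath G r (y # ws)"
  by (auto simp: nbpath_def dest: nonbacktracking_Cons)

text \<open>Common first vertices are stripped by induction. If the second vertices differ,
  reversing one path and joining it to the other at \<open>x\<close> gives a non-backtracking walk
  that meets \<open>r\<close> at both ends, although such walks have distinct entries.\<close>

lemma nbpath_unique:
  assumes G: "simple_graph G" "\<nexists>c. cycle G c"
    and "nbpath G r ws" "nbpath G r vs" "hd ws = hd vs"
  shows "ws = vs"
  using assms(3-5)
proof (induction ws arbitrary: vs)
  case (Cons x ws)
  have dist: "distinct us" if "nbpath G r us" for us
    using that nonbacktracking_distinct[OF G] by (auto simp: nbpath_def)
  from Cons.prems obtain us where vs: "vs = x # us" by (cases vs) auto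
  show ?case
  proof (cases ws)
    case Nil
    then have "last vs = x" using Cons.prems by (simp add: nbpath_def)
    then have "us = []" using dist[OF Cons.prems(2)] vs by (auto split: if_splits)
    with Nil vs show ?thesis by simp
  next
    case (Cons p ps)
    note ws = this
    show ?thesis
    proof (cases us)
      case Nil
      then have "last (x # ws) = x" using Cons.prems vs ws by (auto simp: nbpath_def)
      then show ?thesis using dist[OF Cons.prems(1)] ws by (auto split: if_splits)
    next
      case (Cons q qs)
      show ?thesis
      proof (cases "p = q")
        case True
        then show ?thesis
          using Cons.IH[of us] Cons.prems vs ws Cons by (auto dest: nbpath_tl)
      next
        case False
        have vx: "successively (adj G) (x # us)" "nonbacktracking (x # us)" "last us = r"
          and wx: "successively (adj G) (x # ws)" "nonbacktracking (x # ws)" "last ws = r"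
          using Cons.prems vs ws Cons by (auto simp: nbpath_def)
        have "successively (\<lambda>x y. adj G y x) (x # us)"
          using vx(1) by (metis adj_sym successively_mono)
        then have "successively (adj G) (rev us @ x # ws)"
          using wx(1) Cons ws
          by (auto simp: successively_append_iff successively_rev successively_Cons last_rev dest: adj_sym)
        moreover have "nonbacktracking (rev us @ x # ws)"
          using nonbacktracking_rev[OF vx(2)] wx(2) False Cons ws
          by (intro nonbacktracking_append[of "rev us" x ws]) (auto simp: last_rev)
        ultimately have "distinct (rev us @ x # ws)" by (rule nonbacktracking_distinct[OF G])
        moreover have "r \<in> set us" "r \<in> set ws"
          using vx(3) wx(3) Cons ws last_in_set by (metis list.distinct(1))+
        ultimately show ?thesis by auto
      qed
    qed
  qed
qed simp

text \<open>Reducing a walk: putting a vertex in front of a reduced path either extends it or, when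
  that vertex is already the second entry, cancels the first entry.\<close>

lemma nbpath_exists:
  assumes "xs \<noteq> []" "successively (adj G) xs" "last xs = r"
  shows "\<exists>ws. nbpath G r ws \<and> hd ws = hd xs"
  using assms
proof (induction xs)
  case (Cons x xs)
  show ?case
  proof (cases xs)
    case Nil
    then show ?thesis using Cons.prems by (intro exI[of _ "[r]"]) auto
  next
    case (Cons y ys)
    with Cons.prems Cons.IH obtain ws where ws: "nbpath G r ws" "hd ws = y" and xy: "adj G x y"
      by auto
    then obtain vs where vs: "ws = y # vs" by (cases ws) auto
    show ?thesis
    proof (cases "vs \<noteq> [] \<and> hd vs = x")
      case True
      then show ?thesis using ws vs by (intro exI[of _ vs]) (cases vs; auto dest: nbpath_tl)
    next
      case False
      then have "nbpath G r (x # ws)"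
        using ws xy vs by (cases vs) (auto simp: nbpath_pair nbpath_Cons3)
      then show ?thesis by (intro exI[of _ "x # ws"]) simp
    qed
  qed
qed simp

section \<open>Trees coloured by the classes of a degree matrix\<close>

locale coloured_tree =
  fixes T :: "'a sgraph" and \<kappa> :: "'a \<Rightarrow> nat" and D :: "nat mat" and t :: nat
  assumes tree: "tree T"
    and colour: "\<And>x. x \<in> verts T \<Longrightarrow> \<kappa> x < t"
    and finite_nbrs_colour: "\<And>x j. x \<in> verts T \<Longrightarrow> j < t \<Longrightarrow>
      finite (nbrs T x \<inter> {y \<in> verts T. \<kappa> y = j})"
    and card_nbrs_colour: "\<And>x j. x \<in> verts T \<Longrightarrow> j < t \<Longrightarrow>
      card (nbrs T x \<inter> {y \<in> verts T. \<kappa> y = j}) = D $$ (\<kappa> x, j)"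

lemma degree_matrix_for_coloured_tree:
  assumes "tree H" "degree_matrix_for D H" "dim_row D = t"
  obtains \<kappa> where "coloured_tree H \<kappa> D t"
proof -
  have "\<exists>U :: nat \<Rightarrow> 'a set. (\<forall>i<t. U i \<noteq> {}) \<and> disjoint_family_on U {..<t} \<and>
      verts H = (\<Union>i<t. U i) \<and> (\<forall>i<t. \<forall>j<t. \<forall>x\<in>U i.
        finite (nbrs H x \<inter> U j) \<and> card (nbrs H x \<inter> U j) = D $$ (i, j))"
    using assms(2) unfolding degree_matrix_for_def Let_def assms(3) .
  then obtain U :: "nat \<Rightarrow> 'a set" where U: "disjoint_family_on U {..<t}" "verts H = (\<Union>i<t. U i)"
    "\<And>i j x. i < t \<Longrightarrow> j < t \<Longrightarrow> x \<in> U i \<Longrightarrow>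
       finite (nbrs H x \<inter> U j) \<and> card (nbrs H x \<inter> U j) = D $$ (i, j)"
    by (elim exE conjE) (rule that, assumption, assumption, blast)
  define \<kappa> where "\<kappa> x = (SOME i. i < t \<and> x \<in> U i)" for x
  have \<kappa>: "\<kappa> x < t \<and> x \<in> U (\<kappa> x)" if "x \<in> verts H" for x
  proof -
    have "\<exists>i. i < t \<and> x \<in> U i" using that U(2) by auto
    then show ?thesis unfolding \<kappa>_def by (rule someI_ex)
  qed
  have "U j = {y \<in> verts H. \<kappa> y = j}" if "j < t" for j
  proof -
    have "\<kappa> y = j \<and> y \<in> verts H" if "y \<in> U j" for y
    proof -
      have y: "y \<in> verts H" using that U(2) \<open>j < t\<close> by auto
      then show ?thesis
        using disjoint_family_onD[OF U(1), of "\<kappa> y" j] \<kappa>[OF y] that \<open>j < t\<close> by auto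
    qed
    then show ?thesis using \<kappa> by auto
  qed
  then show ?thesis using \<kappa> U(3) assms(1) by (intro that[of \<kappa>] coloured_tree.intro) auto
qed

context coloured_tree
begin

lemma simple: "simple_graph T" and acyclic: "\<nexists>c. cycle T c"
  using tree by (auto simp: tree_def)

lemma adj_verts: "adj T x y \<Longrightarrow> x \<in> verts T \<and> y \<in> verts T \<and> x \<noteq> y"
  using simple_graphD[OF simple] by blast

text \<open>Equally coloured vertices have equally many neighbours in each class. Bijections chosen
  class by class glue to an injection, since the colour of the image tells which class was
  used.\<close>

lemma nbrs_injection:
  assumes "x \<in> verts T" "y \<in> verts T" "\<kappa> x = \<kappa> y"
  shows "\<exists>b. inj_on b (nbrs T x) \<and> b ` nbrs T x \<subseteq> nbrs T y \<and> (\<forall>z\<in>nbrs T x. \<kappa> (b z) = \<kappa> z)"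
proof -
  let ?N = "\<lambda>x j. nbrs T x \<inter> {y \<in> verts T. \<kappa> y = j}"
  have "\<exists>b. bij_betw b (?N x j) (?N y j)" if "j < t" for j
    using assms that by (intro finite_same_card_bij) (auto simp: finite_nbrs_colour card_nbrs_colour)
  then obtain b where b: "\<And>j. j < t \<Longrightarrow> bij_betw (b j) (?N x j) (?N y j)" by metis
  have N: "z \<in> ?N x (\<kappa> z) \<and> \<kappa> z < t" if "z \<in> nbrs T x" for z
    using that adj_verts colour by (auto simp: nbrs_def)
  have bz: "b (\<kappa> z) z \<in> ?N y (\<kappa> z)" if "z \<in> nbrs T x" for z
    using bij_betw_apply[OF b] N[OF that] by blast
  have "inj_on (\<lambda>z. b (\<kappa> z) z) (nbrs T x)"
  proof (rule inj_onI)
    fix z w assume zw: "z \<in> nbrs T x" "w \<in> nbrs T x" and eq: "b (\<kappa> z) z = b (\<kappa> w) w"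
    have "\<kappa> z = \<kappa> w" using bz[OF zw(1)] bz[OF zw(2)] eq by simp
    then show "z = w"
      using eq b[of "\<kappa> z"] N[OF zw(1)] N[OF zw(2)] by (auto simp: bij_betw_def dest: inj_onD)
  qed
  then show ?thesis using bz by (intro exI[of _ "\<lambda>z. b (\<kappa> z) z"]) auto
qed

text \<open>The constraint \<open>b q = q'\<close> fixes the image of the edge back to the root,
  along which the map is already built. It is conditional so that a choice exists for arbitrary
  \<open>q\<close> and \<open>q'\<close>. The value depends on \<open>x\<close> and
  \<open>y\<close>, not on the neighbour reached, so all neighbours of \<open>x\<close> are moved by
  one injection.\<close>

definition transfer :: "'a \<Rightarrow> 'a \<Rightarrow> 'a \<Rightarrow> 'a \<Rightarrow> 'a \<Rightarrow> 'a" where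
  "transfer x q y q' = (SOME b. inj_on b (nbrs T x) \<and> b ` nbrs T x \<subseteq> nbrs T y \<and>
     (\<forall>z\<in>nbrs T x. \<kappa> (b z) = \<kappa> z) \<and>
     (q \<in> nbrs T x \<and> q' \<in> nbrs T y \<and> \<kappa> q = \<kappa> q' \<longrightarrow> b q = q'))"

lemma transfer:
  assumes "x \<in> verts T" "y \<in> verts T" "\<kappa> x = \<kappa> y"
  shows "inj_on (transfer x q y q') (nbrs T x)"
    and "z \<in> nbrs T x \<Longrightarrow> transfer x q y q' z \<in> nbrs T y"
    and "z \<in> nbrs T x \<Longrightarrow> \<kappa> (transfer x q y q' z) = \<kappa> z"
    and "q \<in> nbrs T x \<Longrightarrow> q' \<in> nbrs T y \<Longrightarrow> \<kappa> q = \<kappa> q' \<Longrightarrow> transfer x q y q' q = q'"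
proof -
  obtain b where b: "inj_on b (nbrs T x)" "b ` nbrs T x \<subseteq> nbrs T y"
    "\<And>z. z \<in> nbrs T x \<Longrightarrow> \<kappa> (b z) = \<kappa> z"
    using nbrs_injection[OF assms] by blast
  have "\<exists>b. inj_on b (nbrs T x) \<and> b ` nbrs T x \<subseteq> nbrs T y \<and>
     (\<forall>z\<in>nbrs T x. \<kappa> (b z) = \<kappa> z) \<and>
     (q \<in> nbrs T x \<and> q' \<in> nbrs T y \<and> \<kappa> q = \<kappa> q' \<longrightarrow> b q = q')"
  proof (cases "q \<in> nbrs T x \<and> q' \<in> nbrs T y \<and> \<kappa> q = \<kappa> q'")
    case True
    \<comment> \<open>Exchanging two values of \<open>b\<close> keeps injectivity. Colours survive
      because a neighbour formerly sent to \<open>q'\<close> has the colour of \<open>q'\<close>,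
      which is that of \<open>q\<close> and hence of \<open>b q\<close>.\<close>
    define b' where "b' z = (if z = q then q' else if b z = q' then b q else b z)" for z
    have "inj_on b' (nbrs T x)"
      using b(1) True unfolding inj_on_def b'_def by metis
    moreover have "b' ` nbrs T x \<subseteq> nbrs T y" using b(2) True by (auto simp: b'_def)
    moreover have "\<kappa> (b' z) = \<kappa> z" if "z \<in> nbrs T x" for z
      using b(3)[OF that] b(3)[of q] True by (auto simp: b'_def)
    ultimately show ?thesis by (intro exI[of _ b']) (auto simp: b'_def)
  next
    case False
    then show ?thesis using b by blast
  qed
  note spec = someI_ex[OF this, folded transfer_def]
  show "inj_on (transfer x q y q') (nbrs T x)"
    and "z \<in> nbrs T x \<Longrightarrow> transfer x q y q' z \<in> nbrs T y"
    and "z \<in> nbrs T x \<Longrightarrow> \<kappa> (transfer x q y q' z) = \<kappa> z"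
    and "q \<in> nbrs T x \<Longrightarrow> q' \<in> nbrs T y \<Longrightarrow> \<kappa> q = \<kappa> q' \<Longrightarrow> transfer x q y q' q = q'"
    using spec by blast+
qed

text \<open>In the second equation the pair \<open>p\<close>, \<open>p\<close> is a dummy: a vertex is not its own
  neighbour, so it imposes no constraint on the transfer at the root.\<close>

fun unfold_path :: "'a \<Rightarrow> 'a list \<Rightarrow> 'a" where
  "unfold_path y (z # p # q # ws) =
     transfer p q (unfold_path y (p # q # ws)) (unfold_path y (q # ws)) z"
| "unfold_path y [z, p] = transfer p p y p z"
| "unfold_path y ws = y"

lemma unfold_path:
  assumes "r \<in> verts T" "y \<in> verts T" "\<kappa> r = \<kappa> y" "nbpath T r ws"
  shows "unfold_path y ws \<in> verts T \<and> \<kappa> (unfold_path y ws) = \<kappa> (hd ws) \<and> hd ws \<in> verts T \<and>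
    (tl ws \<noteq> [] \<longrightarrow> unfold_path y ws \<in> nbrs T (unfold_path y (tl ws)))"
  using assms(2-4)
proof (induction y ws rule: unfold_path.induct)
  case (1 y z p q ws)
  let ?u = "unfold_path y (p # q # ws)"
  have z: "z \<in> nbrs T p" and IH: "?u \<in> verts T" "\<kappa> ?u = \<kappa> p" "p \<in> verts T"
    using 1 by (auto simp: nbpath_Cons3 nbrs_def dest: adj_sym)
  show ?case
    using transfer(2,3)[of p ?u z q "unfold_path y (q # ws)"] IH z adj_verts
    by (auto simp: nbrs_def)
next
  case (2 y z p)
  then have "z \<in> nbrs T r" "p = r" by (auto simp: nbpath_pair nbrs_def dest: adj_sym)
  then show ?case
    using transfer(2,3)[of r y z r r] assms(1) 2 adj_verts by (auto simp: nbrs_def)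
qed (use assms(1) in auto)

text \<open>Each vertex \<open>z\<close> has a unique non-backtracking path \<open>w z\<close> to
  \<open>r\<close>, and \<open>\<psi>\<close> develops the tree along it: the image of
  \<open>z\<close> is determined by the images of its parent and grandparent through
  \<open>transfer\<close>.\<close>

lemma colour_homogeneous:
  assumes r: "r \<in> verts T" and y: "y \<in> verts T" and ry: "\<kappa> r = \<kappa> y"
  shows "\<exists>\<psi>. locally_injective_hom T T \<psi> \<and> \<psi> r = y"
proof -
  have "\<exists>ws. nbpath T r ws \<and> hd ws = z" if z: "z \<in> verts T" for z
    using tree that r nbpath_exists unfolding tree_def connected_graph_def walk_def by metis
  then obtain w where w: "\<And>z. z \<in> verts T \<Longrightarrow> nbpath T r (w z) \<and> hd (w z) = z"
    by metis
  have w_eq: "w z = ws" if "nbpath T r ws" "hd ws = z" "z \<in> verts T" for z ws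
    using nbpath_unique[OF simple acyclic] w[OF that(3)] that by metis
  define \<psi> where "\<psi> z = unfold_path y (w z)" for z
  \<comment> \<open>For adjacent vertices one is the parent of the other, so their paths differ by
    one entry.\<close>
  have step: "w z = z # w x \<or> w x = x # w z" if "adj T x z" for x z
  proof -
    have xz: "x \<in> verts T" "z \<in> verts T" using adj_verts[OF that] by auto
    obtain us where us: "w x = x # us" using w[OF xz(1)] by (cases "w x") auto
    show ?thesis
    proof (cases "us \<noteq> [] \<and> hd us = z")
      case True
      then have "w z = us" using w[OF xz(1)] us xz by (intro w_eq) (cases us; auto dest: nbpath_tl)+
      then show ?thesis using us by simp
    next
      case False
      then have "nbpath T r (z # w x)"
        using w[OF xz(1)] us that
        by (cases us) (auto simp: nbpath_pair nbpath_Cons3 dest: adj_sym)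
      then show ?thesis using w_eq xz by auto
    qed
  qed
  note up = unfold_path[OF r y ry]
  have "\<psi> z \<in> verts T" if "z \<in> verts T" for z
    using up w[OF that] by (simp add: \<psi>_def)
  moreover have "adj T (\<psi> x) (\<psi> z)" if xz: "adj T x z" for x z
  proof -
    have *: "adj T (\<psi> x) (\<psi> z)" if "w z = z # w x" "adj T x z" for x z
    proof -
      have "x \<in> verts T" "z \<in> verts T" using adj_verts[OF that(2)] by auto
      moreover from this have "w x \<noteq> []" using w by (metis nbpath_Nil)
      ultimately show ?thesis using up[of "w z"] w[of z] that(1) by (auto simp: \<psi>_def nbrs_def)
    qed
    show ?thesis using step[OF xz] *[of z x] *[of x z] xz adj_sym by metis
  qed
  moreover have "inj_on \<psi> (nbrs T x)" if x: "x \<in> verts T" for x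
  proof -
    obtain us where us: "w x = x # us" using w[OF x] by (cases "w x") auto
    have ux: "\<psi> x \<in> verts T" "\<kappa> (\<psi> x) = \<kappa> x" using up w[OF x] by (auto simp: \<psi>_def)
    \<comment> \<open>Local injectivity reduces to this: a single transfer gives the images of all
      neighbours of \<open>x\<close>. Children satisfy it by definition; the parent \<open>q\<close>
      satisfies it by the constraint built into \<open>transfer\<close>.\<close>
    have "\<exists>q q'. \<forall>z\<in>nbrs T x. \<psi> z = transfer x q (\<psi> x) q' z"
    proof (cases us)
      case Nil
      then have "x = r" using w[OF x] us by simp
      have "\<psi> z = transfer x x (\<psi> x) x z" if "z \<in> nbrs T x" for z
      proof -
        have "adj T x z" using that by (simp add: nbrs_def)
        then have "w z \<noteq> []" using w adj_verts by (metis nbpath_Nil)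
        then have "w z = [z, x]" using step[OF \<open>adj T x z\<close>] us Nil by auto
        then show ?thesis using us Nil by (simp add: \<psi>_def)
      qed
      then show ?thesis by blast
    next
      case (Cons q qs)
      have nb: "nbpath T r (x # q # qs)" using w[OF x] us Cons by simp
      then have q: "q \<in> nbrs T x" "nbpath T r (q # qs)" by (auto simp: nbrs_def dest: nbpath_tl)
      have "\<psi> z = transfer x q (\<psi> x) (unfold_path y (q # qs)) z" if "z \<in> nbrs T x" for z
      proof -
        have "adj T x z" using that by (simp add: nbrs_def)
        from step[OF this] consider "w z = z # x # q # qs" | "w z = q # qs" using us Cons by auto
        then show ?thesis
        proof cases
          case 1
          then show ?thesis using us Cons by (simp add: \<psi>_def)
        next
          case 2
          then have "z = q" using w adj_verts[OF \<open>adj T x z\<close>] by (metis list.sel(1))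
          have "\<psi> x \<in> nbrs T (unfold_path y (q # qs))"
            using up[OF nb] us Cons by (simp add: \<psi>_def)
          then have "unfold_path y (q # qs) \<in> nbrs T (\<psi> x)" by (auto simp: nbrs_def dest: adj_sym)
          then show ?thesis
            using transfer(4)[OF x ux(1) ux(2)[symmetric] q(1)] up[OF q(2)] 2 \<open>z = q\<close>
            by (simp add: \<psi>_def)
        qed
      qed
      then show ?thesis by blast
    qed
    then obtain q q' where "\<And>z. z \<in> nbrs T x \<Longrightarrow> \<psi> z = transfer x q (\<psi> x) q' z" by blast
    then show ?thesis
      using transfer(1)[OF x ux(1) ux(2)[symmetric]] by (subst inj_on_cong) auto
  qed
  moreover have "w r = [r]" using w_eq r by simp
  then have "\<psi> r = y" by (simp add: \<psi>_def)
  ultimately show ?thesis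
    unfolding locally_injective_hom_def by (intro exI[of _ \<psi>]) simp
qed

end

section \<open>Balls\<close>

text \<open>This is the vertex set of \<open>graph_ball G r v\<close>, phrased by walks to avoid the
  infimum in \<open>graph_dist\<close>. The \<open>Suc\<close> is there because a walk with
  \<open>r\<close> edges lists \<open>r + 1\<close> vertices.\<close>

definition reach :: "'a sgraph \<Rightarrow> nat \<Rightarrow> 'a \<Rightarrow> 'a set" where
  "reach G r v = {u. \<exists>xs. walk G v xs u \<and> length xs \<le> Suc r}"

lemma walk_join:
  assumes "walk G u xs v" "walk G v ys w"
  shows "walk G u (xs @ tl ys) w"
proof (cases ys)
  case (Cons y zs)
  show ?thesis
  proof (cases zs)
    case Nil
    then show ?thesis using assms Cons by (auto simp: walk_def)
  next
    case (Cons z us)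
    then show ?thesis
      using assms \<open>ys = y # zs\<close> by (auto simp: walk_def successively_append_iff)
  qed
qed (use assms in \<open>auto simp: walk_def\<close>)

lemma reach_subset_verts: "reach G r v \<subseteq> verts G"
  by (auto simp: reach_def walk_def)

lemma reach_mono: "r \<le> s \<Longrightarrow> reach G r v \<subseteq> reach G s v"
  by (auto simp: reach_def intro: le_trans)

lemma reach_self: "v \<in> verts G \<Longrightarrow> v \<in> reach G r v"
  by (auto simp: reach_def walk_def intro!: exI[of _ "[v]"])

lemma finite_subset_reach:
  assumes conn: "connected_graph G" and S: "finite S" "S \<subseteq> verts G" and v: "v \<in> verts G"
  obtains r where "S \<subseteq> reach G r v"
proof -
  have "\<exists>xs. walk G v xs x" if "x \<in> S" for x
    using conn v S(2) that by (auto simp: connected_graph_def)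
  then obtain p where p: "\<And>x. x \<in> S \<Longrightarrow> walk G v (p x) x" by metis
  have "length (p x) \<le> Suc (\<Sum>x\<in>S. length (p x))" if "x \<in> S" for x
    using member_le_sum[of x S "\<lambda>x. length (p x)"] that S(1) by simp
  then have "S \<subseteq> reach G (\<Sum>x\<in>S. length (p x)) v" using p by (auto simp: reach_def)
  then show ?thesis using that by blast
qed

lemma reach_sym: "u \<in> reach G r v \<Longrightarrow> v \<in> reach G r u"
proof -
  assume "u \<in> reach G r v"
  then obtain xs where "walk G v xs u" "length xs \<le> Suc r" by (auto simp: reach_def)
  then have "walk G u (rev xs) v \<and> length (rev xs) \<le> Suc r" by (simp add: walk_rev)
  then show ?thesis unfolding reach_def by blast
qed

lemma reach_trans:
  assumes "v \<in> reach G r u" "w \<in> reach G s v"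
  shows "w \<in> reach G (r + s) u"
proof -
  obtain xs ys where "walk G u xs v" "length xs \<le> Suc r" "walk G v ys w" "length ys \<le> Suc s"
    using assms by (auto simp: reach_def)
  then show ?thesis
    unfolding reach_def by (auto intro!: exI[of _ "xs @ tl ys"] walk_join)
qed

lemma reach_adj:
  assumes "simple_graph G" "adj G x y" shows "y \<in> reach G 1 x"
  using simple_graphD[OF assms] assms(2)
  by (auto simp: reach_def walk_def intro!: exI[of _ "[x, y]"])

lemma reach_hom:
  assumes hom: "locally_injective_hom H G \<pi>" and u: "u \<in> reach H r v"
  shows "\<pi> u \<in> reach G r (\<pi> v)"
proof -
  obtain xs where xs: "walk H v xs u" "length xs \<le> Suc r" using u by (auto simp: reach_def)
  have "successively (adj H) xs" using xs(1) by (simp add: walk_def)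
  then have "successively (\<lambda>x y. adj G (\<pi> x) (\<pi> y)) xs"
    by (rule successively_mono) (use hom in \<open>auto simp: locally_injective_hom_def\<close>)
  then have "walk G (\<pi> v) (map \<pi> xs) (\<pi> u)"
    using xs(1) hom by (auto simp: walk_def locally_injective_hom_def hd_map last_map successively_map)
  then show ?thesis using xs(2) unfolding reach_def by force
qed

text \<open>Enlarging the radius by one adds at most \<open>K\<close> neighbours for each vertex
  already reached, a factor of at most \<open>K + 1\<close>.\<close>

lemma reach_card:
  assumes deg: "\<And>x. x \<in> verts G \<Longrightarrow> finite (nbrs G x) \<and> card (nbrs G x) \<le> K"
  shows "finite (reach G r v) \<and> card (reach G r v) \<le> (K + 1) ^ r"
proof (induction r)
  case 0
  have "reach G 0 v \<subseteq> {v}"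
  proof
    fix u assume "u \<in> reach G 0 v"
    then obtain xs where "walk G v xs u" "length xs \<le> 1" by (auto simp: reach_def)
    then show "u \<in> {v}" by (cases xs) (auto simp: walk_def)
  qed
  then show ?case using card_mono[of "{v}" "reach G 0 v"] finite_subset by fastforce
next
  case (Suc r)
  let ?R = "reach G r v"
  have sub: "reach G (Suc r) v \<subseteq> ?R \<union> (\<Union>u\<in>?R. nbrs G u)"
  proof
    fix u assume "u \<in> reach G (Suc r) v"
    then obtain xs where xs: "walk G v xs u" "length xs \<le> Suc (Suc r)" by (auto simp: reach_def)
    then obtain ys where ys: "xs = ys @ [u]"
      by (metis walk_def append_butlast_last_id)
    show "u \<in> ?R \<union> (\<Union>u\<in>?R. nbrs G u)"
    proof (cases "ys = []")
      case True
      then show ?thesis using xs ys by (auto simp: walk_def intro!: reach_self)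
    next
      case False
      then have "walk G v ys (last ys)" "adj G (last ys) u"
        using xs(1) ys by (auto simp: walk_def successively_append_iff)
      then show ?thesis using xs(2) ys by (auto simp: reach_def nbrs_def)
    qed
  qed
  have fin: "finite (?R \<union> (\<Union>u\<in>?R. nbrs G u))"
    using Suc deg reach_subset_verts[of G r v] by blast
  have "card (reach G (Suc r) v) \<le> card ?R + card (\<Union>u\<in>?R. nbrs G u)"
    using card_mono[OF fin sub] card_Un_le le_trans by blast
  also have "card (\<Union>u\<in>?R. nbrs G u) \<le> (\<Sum>u\<in>?R. card (nbrs G u))"
    using Suc by (intro card_UN_le) auto
  also have "\<dots> \<le> (\<Sum>u\<in>?R. K)"
    using deg reach_subset_verts[of G r v] by (intro sum_mono) auto
  also have "card ?R + (\<Sum>u\<in>?R. K) = card ?R * (K + 1)" by simp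
  also have "\<dots> \<le> (K + 1) ^ Suc r" using Suc unfolding power_Suc2 by (intro mult_le_mono1) simp
  finally show ?case using finite_subset[OF sub fin] by simp
qed

lemma verts_graph_ball: "verts (graph_ball G r v) = reach G r v"
proof -
  have "graph_dist G v u \<le> enat r \<longleftrightarrow> (\<exists>xs. walk G v xs u \<and> length xs \<le> Suc r)" for u
  proof -
    \<comment> \<open>An infimum is compared through strict inequalities, so the bound is shifted by
      one.\<close>
    have "graph_dist G v u \<le> enat r \<longleftrightarrow> graph_dist G v u < enat (Suc r)"
      by (cases "graph_dist G v u") auto
    also have "\<dots> \<longleftrightarrow> (\<exists>xs. walk G v xs u \<and> length xs - 1 < Suc r)"
      unfolding graph_dist_def Inf_less_iff by auto
    also have "\<dots> \<longleftrightarrow> (\<exists>xs. walk G v xs u \<and> length xs \<le> Suc r)"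
      by (intro ex_cong1) auto
    finally show ?thesis .
  qed
  then show ?thesis
    using reach_subset_verts[of G r v] by (auto simp: graph_ball_def induced_def reach_def)
qed

section \<open>Rayleigh quotients and the spectral radius\<close>

lemma qform_graph_ball: "qform (graph_ball G r v) (reach G r v) f = qform G (reach G r v) f"
proof -
  have "adj (graph_ball G r v) x y \<longleftrightarrow> adj G x y" if "x \<in> reach G r v" "y \<in> reach G r v" for x y
    using that unfolding verts_graph_ball[symmetric]
    by (auto simp: graph_ball_def induced_def adj_def)
  then show ?thesis unfolding qform_def by (intro sum.cong) auto
qed

lemma qform_le_abs: "qform G S f \<le> qform G S (\<lambda>x. \<bar>f x\<bar>)"
  unfolding qform_def by (intro sum_mono) (auto simp flip: abs_mult)

text \<open>The product \<open>f x * f y\<close> is at most half the sum of the two squares. By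
  symmetry each \<open>x\<close> is then charged its square once per neighbour. This bounds all
  Rayleigh quotients by \<open>K\<close>.\<close>

lemma qform_le_degree:
  assumes fin: "finite S" and deg: "\<And>x. x \<in> S \<Longrightarrow> finite (nbrs G x) \<and> card (nbrs G x) \<le> K"
  shows "qform G S f \<le> real K * (\<Sum>x\<in>S. (f x)\<^sup>2)"
proof -
  let ?a = "\<lambda>x y. if adj G x y then (f x)\<^sup>2 / 2 else 0"
  have swap: "(\<Sum>x\<in>S. \<Sum>y\<in>S. ?a y x) = (\<Sum>x\<in>S. \<Sum>y\<in>S. ?a x y)"
    by (rule sum.swap)
  have "qform G S f \<le> (\<Sum>x\<in>S. \<Sum>y\<in>S. ?a x y + ?a y x)"
    unfolding qform_def
  proof (intro sum_mono)
    fix x y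
    have "0 \<le> (f x - f y)\<^sup>2" by simp
    then have "f x * f y \<le> (f x)\<^sup>2 / 2 + (f y)\<^sup>2 / 2"
      by (simp add: power2_eq_square algebra_simps)
    then show "(if adj G x y then f x * f y else 0) \<le> ?a x y + ?a y x"
      by (auto dest: adj_sym)
  qed
  also have "\<dots> = (\<Sum>x\<in>S. \<Sum>y\<in>S. if adj G x y then (f x)\<^sup>2 else 0)"
    unfolding sum.distrib swap by (simp flip: sum.distrib) (intro sum.cong refl, auto)
  also have "\<dots> = (\<Sum>x\<in>S. real (card (S \<inter> nbrs G x)) * (f x)\<^sup>2)"
    using fin by (intro sum.cong refl) (simp add: nbrs_def Int_def flip: sum.inter_filter)
  also have "\<dots> \<le> (\<Sum>x\<in>S. real K * (f x)\<^sup>2)"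
  proof (intro sum_mono mult_right_mono)
    fix x assume "x \<in> S"
    then have "card (S \<inter> nbrs G x) \<le> K"
      using deg[of x] card_mono[of "nbrs G x" "S \<inter> nbrs G x"] by auto
    then show "real (card (S \<inter> nbrs G x)) \<le> real K" by simp
  qed simp
  finally show ?thesis by (simp add: sum_distrib_left)
qed

text \<open>In the infinite case the limit defining \<open>graph_rho\<close> is the supremum of the
  Rayleigh quotients of finitely supported functions: every such function eventually lives in the
  ball, and the largest eigenvalue of a ball is itself such a quotient. In the finite case the
  largest eigenvalue is attained.\<close>

lemma graph_rho_approx:
  fixes T :: "'a::linorder sgraph"
  assumes conn: "connected_graph T" 
    and deg: "\<And>x. x \<in> verts T \<Longrightarrow> finite (nbrs T x) \<and> card (nbrs T x) \<le> K"
    and eps: "\<epsilon> > 0"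
  shows "\<exists>S f. finite S \<and> S \<subseteq> verts T \<and> (\<Sum>x\<in>S. (f x)\<^sup>2) > 0 \<and>
    qform T S f > (graph_rho T - \<epsilon>) * (\<Sum>x\<in>S. (f x)\<^sup>2)"
proof (cases "finite (verts T)")
  case True
  have "verts T \<noteq> {}" using conn by (simp add: connected_graph_def)
  from largest_eigenvalue_rayleigh(2)[OF True this] obtain f where
    f: "(\<Sum>x\<in>verts T. (f x)\<^sup>2) > 0" "qform T (verts T) f = graph_rho T * (\<Sum>x\<in>verts T. (f x)\<^sup>2)"
    using True by (auto simp: graph_rho_def)
  then show ?thesis
    using True eps by (intro exI[of _ "verts T"] exI[of _ f]) (auto simp: algebra_simps)
next
  case False
  define Q where "Q = {q. \<exists>S f. finite S \<and> S \<subseteq> verts T \<and> (\<Sum>x\<in>S. (f x)\<^sup>2) > 0 \<and>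
    qform T S f = q * (\<Sum>x\<in>S. (f x)\<^sup>2)}"
  have Q: "\<exists>S f. finite S \<and> S \<subseteq> verts T \<and> (\<Sum>x\<in>S. (f x)\<^sup>2) > 0 \<and>
    qform T S f = q * (\<Sum>x\<in>S. (f x)\<^sup>2)" if "q \<in> Q" for q
    using that by (simp add: Q_def)
  define a where "a v r = largest_eigenvalue (graph_ball T r v)" for v r
  have fin: "finite (reach T r v)" for r v using reach_card[OF deg] by simp
  have ball: "finite (verts (graph_ball T r v))" "verts (graph_ball T r v) \<noteq> {}"
    if "v \<in> verts T" for v r
    using fin reach_self[OF that] by (auto simp: verts_graph_ball)
  have aQ: "a v r \<in> Q" if v: "v \<in> verts T" for v r
    using largest_eigenvalue_rayleigh(2)[OF ball[OF v], of r] fin[of r v] reach_subset_verts[of T r v]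
    unfolding verts_graph_ball qform_graph_ball a_def Q_def by blast
  have bdd: "q \<le> real K" if "q \<in> Q" for q
  proof -
    obtain S f where S: "finite S" "S \<subseteq> verts T" "(\<Sum>x\<in>S. (f x)\<^sup>2) > 0"
      "qform T S f = q * (\<Sum>x\<in>S. (f x)\<^sup>2)"
      using Q \<open>q \<in> Q\<close> by blast
    have "qform T S f \<le> real K * (\<Sum>x\<in>S. (f x)\<^sup>2)"
      using S deg by (intro qform_le_degree) auto
    then show ?thesis using S(3,4) by simp
  qed
  then have "bdd_above Q" by (auto simp: bdd_above_def)
  obtain v0 where v0: "v0 \<in> verts T" using conn by (auto simp: connected_graph_def)
  then have "Q \<noteq> {}" using aQ by blast
  have lim: "a v \<longlonglongrightarrow> Sup Q" if v: "v \<in> verts T" for v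
  proof (rule order_tendstoI)
    fix b assume "b < Sup Q"
    then obtain q where q: "q \<in> Q" "b < q"
      using less_cSup_iff[OF \<open>Q \<noteq> {}\<close> \<open>bdd_above Q\<close>] by blast
    then obtain S f where S: "finite S" "S \<subseteq> verts T" "(\<Sum>x\<in>S. (f x)\<^sup>2) > 0"
      "qform T S f = q * (\<Sum>x\<in>S. (f x)\<^sup>2)"
      using Q by blast
    obtain r0 where r0: "S \<subseteq> reach T r0 v"
      using finite_subset_reach[OF conn S(1,2) v] by blast
    have "b < a v r" if r: "r0 \<le> r" for r
    proof -
      have sub: "S \<subseteq> reach T r v" using r0 reach_mono[OF r] by (rule order_trans)
      let ?f = "\<lambda>x. if x \<in> S then f x else 0"
      have "(\<Sum>x\<in>reach T r v. (?f x)\<^sup>2) = (\<Sum>x\<in>S. (f x)\<^sup>2)"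
        using sub fin[of r v] by (intro sum.mono_neutral_cong_right) auto
      moreover have "qform T (reach T r v) ?f \<le> a v r * (\<Sum>x\<in>reach T r v. (?f x)\<^sup>2)"
        using largest_eigenvalue_rayleigh(1)[OF ball[OF v], of r ?f]
        unfolding verts_graph_ball qform_graph_ball a_def .
      ultimately have "q * (\<Sum>x\<in>S. (f x)\<^sup>2) \<le> a v r * (\<Sum>x\<in>S. (f x)\<^sup>2)"
        using S(4) qform_extend[OF sub fin, of T f] by simp
      then show ?thesis using S(3) q(2) by simp
    qed
    then show "\<forall>\<^sub>F r in sequentially. b < a v r" unfolding eventually_sequentially by blast
  next
    fix b assume "Sup Q < b"
    then have "a v r < b" for r
      using cSup_upper[OF aQ[OF v] \<open>bdd_above Q\<close>] by (rule le_less_trans[rotated])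
    then show "\<forall>\<^sub>F r in sequentially. a v r < b" by simp
  qed
  have "graph_rho T = (THE l. \<forall>v\<in>verts T. a v \<longlonglongrightarrow> l)"
    using False by (simp add: graph_rho_def a_def [abs_def])
  \<comment> \<open>The limit is the same from every base point, and the vertex \<open>v0\<close>
    makes it unique.\<close>
  also have "\<dots> = Sup Q"
    using lim v0 by (intro the_equality) (auto intro: LIMSEQ_unique)
  finally have "graph_rho T - \<epsilon> < Sup Q" using eps by simp
  then obtain q where q: "q \<in> Q" "graph_rho T - \<epsilon> < q"
    using less_cSup_iff[OF \<open>Q \<noteq> {}\<close> \<open>bdd_above Q\<close>] by blast
  then obtain S f where "finite S" "S \<subseteq> verts T" "(\<Sum>x\<in>S. (f x)\<^sup>2) > 0"
      "qform T S f = q * (\<Sum>x\<in>S. (f x)\<^sup>2)"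
    using Q by blast
  then show ?thesis using q(2) by (intro exI[of _ S] exI[of _ f]) auto
qed

section \<open>Transport to the covered graph\<close>

text \<open>The forms are compared for each pair of fibres. Fibres over non-adjacent vertices have
  no edges between them; over adjacent ones the edges form a partial matching, to which
  Cauchy-Schwarz applies.\<close>

lemma pushforward_qform:
  assumes hom: "locally_injective_hom T G \<pi>" and S: "finite S" "S \<subseteq> verts T"
    and f: "\<And>x. f x \<ge> 0"
  shows "\<exists>h. (\<forall>u. h u \<ge> 0) \<and> (\<Sum>u\<in>\<pi> ` S. (h u)\<^sup>2) = (\<Sum>x\<in>S. (f x)\<^sup>2) \<and>
    qform T S f \<le> qform G (\<pi> ` S) h"
proof -
  define F where "F u = {x \<in> S. \<pi> x = u}" for u
  define h where "h u = sqrt (\<Sum>x\<in>F u. (f x)\<^sup>2)" for u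
  have h2: "(h u)\<^sup>2 = (\<Sum>x\<in>F u. (f x)\<^sup>2)" for u by (simp add: h_def sum_nonneg)
  have finF: "finite (F u)" for u using S by (simp add: F_def)
  have fibre: "(\<Sum>u\<in>\<pi> ` S. \<Sum>x\<in>F u. g x) = (\<Sum>x\<in>S. g x)" for g :: "'a \<Rightarrow> real"
    unfolding F_def using S(1) by (rule sum.image_gen[symmetric])
  have le: "(\<Sum>x\<in>F u. \<Sum>y\<in>F w. if adj T x y then f x * f y else 0) \<le>
      (if adj G u w then h u * h w else 0)" for u w
  proof (cases "adj G u w")
    case False
    then have "\<not> adj T x y" if "x \<in> F u" "y \<in> F w" for x y
      using that hom by (auto simp: F_def locally_injective_hom_def)
    then have "(\<Sum>x\<in>F u. \<Sum>y\<in>F w. if adj T x y then f x * f y else 0) = 0"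
      by (intro sum.neutral ballI) auto
    with False show ?thesis by simp
  next
    case True
    define P where "P = {(x, y). x \<in> F u \<and> y \<in> F w \<and> adj T x y}"
    have PF: "P \<subseteq> F u \<times> F w" by (auto simp: P_def)
    then have finP: "finite P" using finF by (meson finite_SigmaI finite_subset)
    \<comment> \<open>Two neighbours of one vertex never share a fibre, so both projections of
      \<open>P\<close> are injective.\<close>
    have inj: "x = y" if "adj T z x" "adj T z y" "\<pi> x = \<pi> y" "z \<in> S" for x y z
      using that hom S by (auto simp: locally_injective_hom_def nbrs_def dest: inj_onD)
    have "inj_on fst P"
      by (auto simp: P_def F_def inj_on_def intro: inj)
    moreover have "fst ` P \<subseteq> F u" by (auto simp: P_def)
    ultimately have 1: "(\<Sum>p\<in>P. (f (fst p))\<^sup>2) \<le> (\<Sum>x\<in>F u. (f x)\<^sup>2)"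
      using finF[of u]
      by (subst sum.reindex[of fst P "\<lambda>x. (f x)\<^sup>2", unfolded o_def, symmetric]) (auto intro!: sum_mono2)
    have "inj_on snd P"
      by (auto simp: P_def F_def inj_on_def intro: inj dest: adj_sym)
    moreover have "snd ` P \<subseteq> F w" by (auto simp: P_def)
    ultimately have 2: "(\<Sum>p\<in>P. (f (snd p))\<^sup>2) \<le> (\<Sum>x\<in>F w. (f x)\<^sup>2)"
      using finF[of w]
      by (subst sum.reindex[of snd P "\<lambda>x. (f x)\<^sup>2", unfolded o_def, symmetric]) (auto intro!: sum_mono2)
    have "(\<Sum>x\<in>F u. \<Sum>y\<in>F w. if adj T x y then f x * f y else 0) =
        (\<Sum>p\<in>F u \<times> F w. if adj T (fst p) (snd p) then f (fst p) * f (snd p) else 0)"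
      by (simp add: sum.cartesian_product split_def)
    also have "\<dots> = (\<Sum>p\<in>P. f (fst p) * f (snd p))"
      using finF PF by (intro sum.mono_neutral_cong_right) (auto simp: P_def)
    also have "\<dots> \<le> L2_set (\<lambda>p. f (fst p)) P * L2_set (\<lambda>p. f (snd p)) P"
      using L2_set_mult_ineq[of "\<lambda>p. f (fst p)" "\<lambda>p. f (snd p)" P] f by simp
    also have "\<dots> \<le> h u * h w"
      unfolding L2_set_def h_def using 1 2 by (intro mult_mono real_sqrt_le_mono) (auto simp: sum_nonneg)
    finally show ?thesis using True by simp
  qed
  have "qform T S f = (\<Sum>u\<in>\<pi> ` S. \<Sum>x\<in>F u. \<Sum>w\<in>\<pi> ` S. \<Sum>y\<in>F w. if adj T x y then f x * f y else 0)"
    unfolding qform_def fibre ..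
  also have "\<dots> = (\<Sum>u\<in>\<pi> ` S. \<Sum>w\<in>\<pi> ` S. \<Sum>x\<in>F u. \<Sum>y\<in>F w. if adj T x y then f x * f y else 0)"
    by (intro sum.cong refl) (rule sum.swap)
  also have "\<dots> \<le> qform G (\<pi> ` S) h"
    unfolding qform_def by (intro sum_mono le)
  finally have "qform T S f \<le> qform G (\<pi> ` S) h" .
  moreover have "(\<Sum>u\<in>\<pi> ` S. (h u)\<^sup>2) = (\<Sum>x\<in>S. (f x)\<^sup>2)" unfolding h2 fibre ..
  moreover have "h u \<ge> 0" for u by (simp add: h_def sum_nonneg)
  ultimately show ?thesis by blast
qed

text \<open>The list repeats its start at the end, so even length means an odd number of edges. A
  repeated inner vertex splits the walk into two shorter closed walks, one of them odd; without a
  repetition the walk is itself a cycle.\<close>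

lemma odd_closed_walk:
  assumes "simple_graph G" "xs \<noteq> []" "hd xs = last xs" "successively (adj G) xs" "even (length xs)"
  shows "\<exists>c. cycle G c \<and> odd (length c) \<and> length c < length xs"
  using assms(2-5)
proof (induction "length xs" arbitrary: xs rule: less_induct)
  case less
  define u where "u = last xs"
  obtain ys where xs: "xs = ys @ [u]"
    using less.prems(1) append_butlast_last_id[of xs] by (metis u_def)
  have "odd (length ys)" using less.prems(4) by (simp add: xs)
  moreover from this have "ys \<noteq> []" by auto
  moreover from this have "hd ys = u" using less.prems(2) by (simp add: xs)
  ultimately have ys: "ys \<noteq> []" "odd (length ys)" "hd ys = u" by simp_all
  show ?case
  proof (cases "distinct ys")
    case True
    have "length ys \<noteq> 1"
    proof
      assume "length ys = 1"
      then have "ys = [u]" using ys by (cases ys) auto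
      then have "adj G u u" using less.prems(3) xs by simp
      then show False using simple_graphD[OF assms(1)] by blast
    qed
    moreover have "length ys \<noteq> 0" "length ys \<noteq> 2" using ys by auto
    ultimately have "3 \<le> length ys" by linarith
    moreover have "adj G (ys ! i) (ys ! (Suc i mod length ys))" if i: "i < length ys" for i
    proof -
      have "adj G (xs ! i) (xs ! Suc i)"
        using less.prems(3) i xs by (simp add: successively_conv_nth)
      then show ?thesis
        using i xs ys by (cases "Suc i = length ys") (auto simp: nth_append hd_conv_nth)
    qed
    ultimately have "cycle G ys" using True by (simp add: cycle_def)
    then show ?thesis using ys xs by auto
  next
    case False
    then obtain a b c p where "ys = a @ [p] @ b @ [p] @ c"
      using not_distinct_decomp by blast
    then have xs': "xs = a @ [p] @ b @ [p] @ c @ [u]" using xs by simp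
    \<comment> \<open>\<open>A\<close> is the loop at \<open>p\<close> and \<open>B\<close> is what
      remains. Their lengths add up to \<open>length xs + 1\<close>, an odd number, so one of them
      is even.\<close>
    define A where "A = [p] @ b @ [p]"
    define B where "B = a @ [p] @ c @ [u]"
    have "successively (adj G) A" "successively (adj G) B"
      using less.prems(3) unfolding xs' A_def B_def
      by (auto simp: successively_append_iff successively_Cons hd_append split: if_splits)
    moreover have "hd A = last A" "hd B = last B" "A \<noteq> []" "B \<noteq> []"
      using less.prems(2) unfolding xs' A_def B_def by (cases a; simp)+
    moreover have "length A < length xs" "length B < length xs"
      unfolding xs' A_def B_def by auto
    moreover have "even (length A) \<or> even (length B)"
      using less.prems(4) unfolding xs' A_def B_def by auto
    ultimately have "\<exists>C\<in>{A, B}. \<exists>c. cycle G c \<and> odd (length c) \<and> length c < length C"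
      using less.hyps by blast
    then show ?thesis
      using \<open>length A < length xs\<close> \<open>length B < length xs\<close> by (auto intro: less_trans)
  qed
qed

text \<open>The sign records the parity of a short walk from \<open>v\<close>. If adjacent vertices
  had walks of equal parity, these walks and the edge would form an odd closed walk listing at most
  \<open>2 * R + 2\<close> vertices, and hence yield an odd cycle shorter than
  \<open>2 * R + 2\<close>.\<close>

lemma odd_girth_signing:
  assumes G: "simple_graph G" and girth: "enat (2 * R + 2) \<le> odd_girth G"
  shows "\<exists>s :: 'a \<Rightarrow> real. (\<forall>u. (s u)\<^sup>2 = 1) \<and>
    (\<forall>u\<in>reach G R v. \<forall>w\<in>reach G R v. adj G u w \<longrightarrow> s u * s w = -1)"
proof -
  define E where "E u \<longleftrightarrow> (\<exists>xs. walk G v xs u \<and> length xs \<le> Suc R \<and> odd (length xs))" for u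
  have parity: "odd (length xs + length ys)"
    if "walk G v xs u" "walk G v ys w" "length xs \<le> Suc R" "length ys \<le> Suc R" "adj G u w"
    for xs ys u w
  proof
    assume ev: "even (length xs + length ys)"
    have "walk G w (rev ys) v" using that(2) by (rule walk_rev)
    then have "hd (xs @ rev ys) = last (xs @ rev ys)" "successively (adj G) (xs @ rev ys)"
      using that by (auto simp: walk_def successively_append_iff hd_rev last_rev)
    moreover have "xs @ rev ys \<noteq> []" using that(1) by (auto simp: walk_def)
    ultimately obtain c where c: "cycle G c" "odd (length c)" "length c < length (xs @ rev ys)"
      using odd_closed_walk[OF G, of "xs @ rev ys"] ev by auto
    have "odd_girth G \<le> enat (length c)"
      unfolding odd_girth_def using c by (intro Inf_lower) auto
    with girth have "enat (2 * R + 2) \<le> enat (length c)" by (rule order_trans)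
    with c(3) that show False by simp
  qed
  define s where "s u = (if E u then 1 else - 1 :: real)" for u
  have "s u * s w = -1" if u: "u \<in> reach G R v" and w: "w \<in> reach G R v" and uw: "adj G u w" for u w
  proof -
    obtain xs ys where xs: "walk G v xs u" "length xs \<le> Suc R" "E u \<Longrightarrow> odd (length xs)"
      and ys: "walk G v ys w" "length ys \<le> Suc R" "E w \<Longrightarrow> odd (length ys)"
      using u w unfolding reach_def E_def by blast
    moreover have "\<not> E u \<Longrightarrow> even (length xs)" "\<not> E w \<Longrightarrow> even (length ys)"
      using xs ys by (auto simp: E_def)
    ultimately show ?thesis using parity[of xs u ys w] uw by (auto simp: s_def)
  qed
  then show ?thesis by (intro exI[of _ s]) (auto simp: s_def)
qed

text \<open>By maximality, the balls of radius \<open>r\<close> around a maximal separated set cover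
  the graph, and each has at most \<open>(K + 1) ^ r\<close> vertices.\<close>

lemma reach_packing:
  assumes fin: "finite (verts G)"
    and deg: "\<And>x. x \<in> verts G \<Longrightarrow> finite (nbrs G x) \<and> card (nbrs G x) \<le> K"
  shows "\<exists>I \<subseteq> verts G. (\<forall>i\<in>I. \<forall>j\<in>I. i \<noteq> j \<longrightarrow> j \<notin> reach G r i) \<and>
    card (verts G) \<le> card I * (K + 1) ^ r"
proof -
  define \<I> where "\<I> = {I. I \<subseteq> verts G \<and> (\<forall>i\<in>I. \<forall>j\<in>I. i \<noteq> j \<longrightarrow> j \<notin> reach G r i)}"
  have "finite \<I>" "{} \<in> \<I>" using fin by (auto simp: \<I>_def)
  then obtain I where I: "I \<in> \<I>" "\<And>J. J \<in> \<I> \<Longrightarrow> I \<subseteq> J \<Longrightarrow> J = I"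
    using finite_has_maximal[of \<I>] by blast
  have "verts G \<subseteq> (\<Union>i\<in>I. reach G r i)"
  proof
    fix v assume v: "v \<in> verts G"
    show "v \<in> (\<Union>i\<in>I. reach G r i)"
    proof (rule ccontr)
      assume "v \<notin> (\<Union>i\<in>I. reach G r i)"
      then have "\<forall>i\<in>I. v \<notin> reach G r i \<and> i \<notin> reach G r v" using reach_sym by fast
      then have "insert v I \<in> \<I>" using I(1) v by (auto simp: \<I>_def)
      then have "v \<in> I" using I(2) by blast
      then show False using \<open>v \<notin> _\<close> v reach_self by fast
    qed
  qed
  moreover have finI: "finite I" using I(1) fin finite_subset by (auto simp: \<I>_def)
  ultimately have "card (verts G) \<le> card (\<Union>i\<in>I. reach G r i)"
    using reach_card[OF deg] by (intro card_mono) auto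
  also have "\<dots> \<le> (\<Sum>i\<in>I. card (reach G r i))" by (rule card_UN_le[OF finI])
  also have "\<dots> \<le> (\<Sum>i\<in>I. (K + 1) ^ r)" using reach_card[OF deg] by (intro sum_mono) auto
  finally show ?thesis using I(1) by (intro exI[of _ I]) (auto simp: \<I>_def)
qed

section \<open>Vertices of every colour within bounded distance\<close>

context coloured_tree
begin

lemma nbrs_bounded:
  assumes x: "x \<in> verts T"
  shows "finite (nbrs T x) \<and> card (nbrs T x) \<le> (\<Sum>i<t. \<Sum>j<t. D $$ (i, j))"
proof -
  have eq: "nbrs T x = (\<Union>j<t. nbrs T x \<inter> {y \<in> verts T. \<kappa> y = j})"
    using adj_verts colour by (auto simp: nbrs_def)
  have fin: "finite (nbrs T x)"
    by (subst eq) (use finite_nbrs_colour[OF x] in blast)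
  have "card (nbrs T x) \<le> (\<Sum>j<t. card (nbrs T x \<inter> {y \<in> verts T. \<kappa> y = j}))"
    by (subst eq) (rule card_UN_le, simp)
  also have "\<dots> = (\<Sum>j<t. D $$ (\<kappa> x, j))" using card_nbrs_colour[OF x] by simp
  also have "\<dots> \<le> (\<Sum>i<t. \<Sum>j<t. D $$ (i, j))"
    using member_le_sum[of "\<kappa> x" "{..<t}" "\<lambda>i. \<Sum>j<t. D $$ (i, j)"] colour[OF x] by simp
  finally show ?thesis using fin by simp
qed

text \<open>A positive entry of \<open>D\<close> provides a neighbour of the next colour. The radius
  exceeds the number of steps by one, which keeps the induction free of subtraction.\<close>

lemma follow_colours:
  assumes "x \<in> verts T" "ms \<noteq> []" "hd ms = \<kappa> x" "set ms \<subseteq> {..<t}"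
    "successively (\<lambda>a b. D $$ (a, b) > 0) ms"
  shows "\<exists>y\<in>reach T (length ms) x. \<kappa> y = last ms"
  using assms
proof (induction ms arbitrary: x)
  case (Cons m ms)
  show ?case
  proof (cases ms)
    case Nil
    then show ?thesis using Cons.prems by (auto intro!: bexI[of _ x] reach_self)
  next
    case (Cons k ks)
    then have k: "k < t" "D $$ (\<kappa> x, k) > 0" using Cons.prems by auto
    then have "nbrs T x \<inter> {y \<in> verts T. \<kappa> y = k} \<noteq> {}"
      using card_nbrs_colour[OF Cons.prems(1), of k] by (metis card.empty less_irrefl)
    then obtain z where z: "adj T x z" "z \<in> verts T" "\<kappa> z = k" by (auto simp: nbrs_def)
    then obtain y where "y \<in> reach T (length ms) z" "\<kappa> y = last ms"
      using Cons.IH[of z] Cons.prems Cons by auto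
    moreover have "z \<in> reach T 1 x" using reach_adj[OF simple z(1)] .
    ultimately show ?thesis using reach_trans[of z T 1 x y "length ms"] Cons by auto
  qed
qed simp

text \<open>(D2) gives a colour sequence to \<open>k\<close> from each of the finitely many colours;
  the sum of their lengths is a radius that serves all vertices.\<close>

lemma colour_nearby:
  assumes D: "degree_matrix t D" and k: "k < t"
  shows "\<exists>R. \<forall>x\<in>verts T. \<exists>y\<in>reach T R x. \<kappa> y = k"
proof -
  have "\<forall>i<t. \<exists>ms. ms \<noteq> [] \<and> set ms \<subseteq> {..<t} \<and> hd ms = i \<and> last ms = k \<and>
      successively (\<lambda>a b. D $$ (a, b) > 0) ms"
    using D k unfolding degree_matrix_def by blast
  then obtain m where m: "\<And>i. i < t \<Longrightarrow> m i \<noteq> [] \<and> set (m i) \<subseteq> {..<t} \<and> hd (m i) = i \<and>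
      last (m i) = k \<and> successively (\<lambda>a b. D $$ (a, b) > 0) (m i)"
    by metis
  have "\<exists>y\<in>reach T (\<Sum>i<t. length (m i)) x. \<kappa> y = k" if x: "x \<in> verts T" for x
  proof -
    have "length (m (\<kappa> x)) \<le> (\<Sum>i<t. length (m i))"
      using member_le_sum[of "\<kappa> x" "{..<t}" "\<lambda>i. length (m i)"] colour[OF x] by simp
    from reach_mono[OF this] have "reach T (length (m (\<kappa> x))) x \<subseteq> reach T (\<Sum>i<t. length (m i)) x" .
    moreover have "\<exists>y\<in>reach T (length (m (\<kappa> x))) x. \<kappa> y = k"
      using follow_colours[OF x, of "m (\<kappa> x)"] m[OF colour[OF x]] by simp
    ultimately show ?thesis by blast
  qed
  then show ?thesis by blast
qed

end

lemma locally_injective_hom_comp: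
  assumes "simple_graph H" "locally_injective_hom H K \<phi>" "locally_injective_hom K G \<pi>"
  shows "locally_injective_hom H G (\<pi> \<circ> \<phi>)"
proof -
  have "inj_on (\<pi> \<circ> \<phi>) (nbrs H x)" if x: "x \<in> verts H" for x
  proof (rule comp_inj_on)
    show "inj_on \<phi> (nbrs H x)" using assms(2) x by (simp add: locally_injective_hom_def)
    have "\<phi> ` nbrs H x \<subseteq> nbrs K (\<phi> x)" "\<phi> x \<in> verts K"
      using assms(2) x by (auto simp: locally_injective_hom_def nbrs_def)
    then show "inj_on \<pi> (\<phi> ` nbrs H x)"
      using assms(3) by (auto simp: locally_injective_hom_def intro: inj_on_subset)
  qed
  then show ?thesis using assms(2,3) by (simp add: locally_injective_hom_def)
qed

section \<open>Linearly many small eigenvalues\<close>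

theorem theorem7p2:
  fixes t :: nat and D :: "nat mat"
  assumes "degree_matrix t D"
  shows "\<forall>\<epsilon>::real. \<epsilon> > 0 \<longrightarrow>
    (\<exists>g::nat. \<forall>\<Delta>::nat. \<Delta> > 0 \<longrightarrow>
      (\<exists>c::real. c > 0 \<and>
        (\<forall>G :: nat sgraph.
           simple_graph G \<and> finite (verts G) \<and>
           (\<forall>v\<in>verts G. card (nbrs G v) \<le> \<Delta>) \<and>
           subdegree_matrix D G \<and> enat g \<le> odd_girth G \<longrightarrow>
           real (size {#x \<in># eigenvalues G. x < - graph_rho (universal_cover D) + \<epsilon>#})
             \<ge> c * real (card (verts G)))))"
proof (intro allI impI)
  fix \<epsilon> :: real assume eps: "\<epsilon> > 0"
  define T where "T = universal_cover D"
  define \<rho> where "\<rho> = graph_rho T"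
  have T: "tree T" "degree_matrix_for D T"
    using universal_cover_exists[OF assms] by (simp_all add: T_def)
  have dim: "dim_row D = t" using assms by (auto simp: degree_matrix_def)
  obtain \<kappa> where "coloured_tree T \<kappa> D t"
    using degree_matrix_for_coloured_tree[OF T dim] .
  then interpret coloured_tree T \<kappa> D t .
  have conn: "connected_graph T" using T(1) by (simp add: tree_def)
  obtain S f0 where S: "finite S" "S \<subseteq> verts T" and f0: "(\<Sum>x\<in>S. (f0 x)\<^sup>2) > 0"
    "qform T S f0 > (\<rho> - \<epsilon>) * (\<Sum>x\<in>S. (f0 x)\<^sup>2)"
    using graph_rho_approx[OF conn nbrs_bounded eps] unfolding \<rho>_def by blast
  \<comment> \<open>Absolute values keep the norm and do not lower the form, and the pushforward
    asks for a nonnegative function.\<close>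
  define f where "f x = \<bar>f0 x\<bar>" for x
  have f: "(\<Sum>x\<in>S. (f x)\<^sup>2) > 0" "qform T S f > (\<rho> - \<epsilon>) * (\<Sum>x\<in>S. (f x)\<^sup>2)"
    using f0 qform_le_abs[of T S f0] by (auto simp: f_def [abs_def])
  obtain x0 where x0: "x0 \<in> verts T" using conn by (auto simp: connected_graph_def)
  obtain r0 where r0: "S \<subseteq> reach T r0 x0" using finite_subset_reach[OF conn S x0] .
  from colour_nearby[OF assms colour[OF x0]]
  obtain R0 where R0: "\<forall>x\<in>verts T. \<exists>y\<in>reach T R0 x. \<kappa> y = \<kappa> x0" ..
  \<comment> \<open>A preimage of \<open>v\<close> lies within \<open>R0\<close> of a vertex
    coloured like \<open>x0\<close>, and the support moved there stays within \<open>r0\<close> of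
    it.\<close>
  define R where "R = R0 + r0"
  show "\<exists>g::nat. \<forall>\<Delta>::nat. \<Delta> > 0 \<longrightarrow>
      (\<exists>c::real. c > 0 \<and>
        (\<forall>G :: nat sgraph.
           simple_graph G \<and> finite (verts G) \<and>
           (\<forall>v\<in>verts G. card (nbrs G v) \<le> \<Delta>) \<and>
           subdegree_matrix D G \<and> enat g \<le> odd_girth G \<longrightarrow>
           real (size {#x \<in># eigenvalues G. x < - graph_rho (universal_cover D) + \<epsilon>#})
             \<ge> c * real (card (verts G))))"
  \<comment> \<open>This girth depends on \<open>D\<close> and \<open>\<epsilon>\<close> only, so it
    can be fixed before \<open>\<Delta>\<close>.\<close>
  proof (rule exI[of _ "2 * R + 2"], intro allI impI)
    fix \<Delta> :: nat assume "\<Delta> > 0"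
    \<comment> \<open>\<open>M\<close> bounds the size of a ball of radius \<open>2 * R + 1\<close>
      in \<open>G\<close>; the constant will be \<open>1 / real M\<close>.\<close>
    define M where "M = (\<Delta> + 1) ^ (2 * R + 1)"
    have "M > 0" by (simp add: M_def)
    have "1 / real M * real (card (verts G))
        \<le> real (size {#x \<in># eigenvalues G. x < - graph_rho (universal_cover D) + \<epsilon>#})"
      if G: "simple_graph G" "finite (verts G)" "\<forall>v\<in>verts G. card (nbrs G v) \<le> \<Delta>"
        "subdegree_matrix D G" "enat (2 * R + 2) \<le> odd_girth G" for G :: "nat sgraph"
    proof -
      have local: "\<exists>S' f'. S' \<subseteq> reach G R v \<and>
          qform G S' f' < (- \<rho> + \<epsilon>) * (\<Sum>u\<in>S'. (f' u)\<^sup>2)" if v: "v \<in> verts G" for v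
      proof -
        have "\<exists>\<pi>. locally_injective_hom T G \<pi> \<and> v \<in> \<pi> ` verts T"
          using G(4) v by (simp add: subdegree_matrix_def T_def)
        then obtain \<pi> x where \<pi>: "locally_injective_hom T G \<pi>" and x: "x \<in> verts T" "\<pi> x = v"
          by auto
        obtain y where y: "y \<in> reach T R0 x" "\<kappa> y = \<kappa> x0" using bspec[OF R0 x(1)] by blast
        have "y \<in> verts T" using subsetD[OF reach_subset_verts y(1)] .
        then obtain \<psi> where \<psi>: "locally_injective_hom T T \<psi>" "\<psi> x0 = y"
          using colour_homogeneous[OF x0 _ y(2)[symmetric]] by blast
        note hom = locally_injective_hom_comp[OF simple \<psi>(1) \<pi>]
        obtain h where h: "(\<Sum>u\<in>(\<pi> \<circ> \<psi>) ` S. (h u)\<^sup>2) = (\<Sum>x\<in>S. (f x)\<^sup>2)"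
          "qform T S f \<le> qform G ((\<pi> \<circ> \<psi>) ` S) h"
          using pushforward_qform[OF hom S, of f] by (auto simp: f_def)
        define S' where "S' = (\<pi> \<circ> \<psi>) ` S"
        have S': "S' \<subseteq> reach G R v"
        proof
          fix u assume "u \<in> S'"
          then obtain z where "z \<in> S" "u = (\<pi> \<circ> \<psi>) z" by (auto simp: S'_def)
          then have "u \<in> reach G r0 (\<pi> y)"
            using reach_hom[OF hom, of z r0 x0] r0 \<psi>(2) by auto
          moreover have "\<pi> y \<in> reach G R0 v" using reach_hom[OF \<pi> y(1)] x(2) by simp
          ultimately show "u \<in> reach G R v" unfolding R_def by (blast intro: reach_trans)
        qed
        obtain s where s: "\<And>u. (s u)\<^sup>2 = (1 :: real)"
          "\<And>u w. u \<in> reach G R v \<Longrightarrow> w \<in> reach G R v \<Longrightarrow> adj G u w \<Longrightarrow> s u * s w = -1"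
          using odd_girth_signing[OF G(1,5), of v] by blast
        have "(if adj G u w then (s u * h u) * (s w * h w) else 0) =
            - (if adj G u w then h u * h w else 0)" if "u \<in> S'" "w \<in> S'" for u w
        proof (cases "adj G u w")
          case True
          have "(s u * h u) * (s w * h w) = (s u * s w) * (h u * h w)" by simp
          also have "s u * s w = -1" using that S' True by (intro s(2)) auto
          finally show ?thesis using True by simp
        qed simp
        then have "qform G S' (\<lambda>u. s u * h u) = - qform G S' h"
          unfolding qform_def by (simp add: sum_negf)
        moreover have "(\<Sum>u\<in>S'. (s u * h u)\<^sup>2) = (\<Sum>x\<in>S. (f x)\<^sup>2)"
          using h(1) by (simp add: S'_def power_mult_distrib s(1))
        ultimately have "qform G S' (\<lambda>u. s u * h u) < (- \<rho> + \<epsilon>) * (\<Sum>u\<in>S'. (s u * h u)\<^sup>2)"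
          using h(2) f(2) by (simp add: S'_def algebra_simps)
        then show ?thesis using S' by blast
      qed
      then obtain S' f' where S': "\<And>v. v \<in> verts G \<Longrightarrow> S' v \<subseteq> reach G R v"
        "\<And>v. v \<in> verts G \<Longrightarrow> qform G (S' v) (f' v) < (- \<rho> + \<epsilon>) * (\<Sum>u\<in>S' v. (f' v u)\<^sup>2)"
        by metis
      \<comment> \<open>Finiteness comes from \<open>verts G\<close>, since the bound on
        \<open>card\<close> alone would admit infinite neighbourhoods.\<close>
      have deg: "finite (nbrs G x) \<and> card (nbrs G x) \<le> \<Delta>" if "x \<in> verts G" for x
      proof -
        have "nbrs G x \<subseteq> verts G" using simple_graphD[OF G(1)] by (auto simp: nbrs_def)
        then show ?thesis using G(2,3) that finite_subset by blast
      qed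
      \<comment> \<open>Centres more than \<open>2 * R + 1\<close> apart have balls of radius
        \<open>R\<close> that neither meet nor are joined by an edge.\<close>
      obtain I where I: "I \<subseteq> verts G" "card (verts G) \<le> card I * M"
        "\<And>i j. i \<in> I \<Longrightarrow> j \<in> I \<Longrightarrow> i \<noteq> j \<Longrightarrow> j \<notin> reach G (2 * R + 1) i"
        using reach_packing[OF G(2) deg, of "2 * R + 1"] unfolding M_def by blast
      have "card I \<le> size {#x \<in># eigenvalues G. x < - \<rho> + \<epsilon>#}"
      proof (rule card_le_eigenvalues_below[OF G(2), of I S' f'])
        show "finite I" using I(1) G(2) finite_subset by blast
        show "S' i \<subseteq> verts G" if "i \<in> I" for i
          using S'(1)[OF subsetD[OF I(1) that]] reach_subset_verts by (rule order_trans)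
        show "qform G (S' i) (f' i) < (- \<rho> + \<epsilon>) * (\<Sum>u\<in>S' i. (f' i u)\<^sup>2)" if "i \<in> I" for i
          by (rule S'(2)[OF subsetD[OF I(1) that]])
        fix i j x y assume ij: "i \<in> I" "j \<in> I" "i \<noteq> j" and xy: "x \<in> S' i" "y \<in> S' j"
        have x: "x \<in> reach G R i" and y: "j \<in> reach G R y"
          using S'(1)[of i] S'(1)[of j] ij xy I(1) by (auto intro: reach_sym)
        \<comment> \<open>Radius 1 excludes equality and adjacency at once.\<close>
        have "y \<notin> reach G 1 x"
        proof
          assume "y \<in> reach G 1 x"
          from reach_trans[OF reach_trans[OF x this] y] have "j \<in> reach G (2 * R + 1) i"
            by (simp add: mult_2)
          with I(3)[OF ij] show False by blast
        qed
        then show "x \<noteq> y \<and> \<not> adj G x y"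
          using reach_adj[OF G(1), of x y] reach_self[of x G 1] x reach_subset_verts[of G R i] by auto
      qed
      then have "card (verts G) \<le> size {#x \<in># eigenvalues G. x < - \<rho> + \<epsilon>#} * M"
        using I(2) by (meson le_trans mult_le_mono1)
      then have "real (card (verts G)) \<le> real (size {#x \<in># eigenvalues G. x < - \<rho> + \<epsilon>#}) * real M"
        by (metis of_nat_le_iff of_nat_mult)
      then show ?thesis using \<open>M > 0\<close> by (simp add: \<rho>_def T_def field_simps)
    qed
    then show "\<exists>c::real. c > 0 \<and>
        (\<forall>G :: nat sgraph.
           simple_graph G \<and> finite (verts G) \<and>
           (\<forall>v\<in>verts G. card (nbrs G v) \<le> \<Delta>) \<and>
           subdegree_matrix D G \<and> enat (2 * R + 2) \<le> odd_girth G \<longrightarrow>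
           real (size {#x \<in># eigenvalues G. x < - graph_rho (universal_cover D) + \<epsilon>#})
             \<ge> c * real (card (verts G)))"
      using \<open>M > 0\<close> by (intro exI[of _ "1 / real M"]) auto
  qed
qed

end
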